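(* Let $\mathbb{F}$ be a field, $k$ an integer, and for every $1 \leq i \leq k$ let $L_i \in \mathbb{F}^{n^{\alpha_i}\times n}$ and $R_i \in \mathbb{F}^{n\times n^{\beta_i}}$ be matrices with $\mathrm{rank}(L_i) = n^{\alpha_i}$ and $\mathrm{rank}(R_i) = n^{\beta_i}$, where $0 \leq \alpha_i, \beta_i \leq 1$. Assume that for all $A, B \in \mathbb{F}^{n\times n}$, $AB = 0$ if and only if $L_i A B R_i = 0$ for all $1 \leq i \leq k$. Then $$\sum_{i=1}^k n^{\alpha_i+\beta_i} \geq n^2, \quad\text{and}\quad \sum_{i=1}^k n^{\omega(1,1,\min(\alpha_i,\beta_i))} \geq \sum_{i=1}^k n^{\omega(\alpha_i,1,\beta_i)} \geq n^{\omega}.$$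
   Context: For $\alpha,\beta,\gamma\in[0,1]$, $\omega(\alpha,\beta,\gamma)$ is the infimum over $\omega'>0$ such that the product of an $n^\alpha\times n^\beta$ matrix and an $n^\beta\times n^\gamma$ matrix can be computed using $O(n^{\omega'})$ arithmetic operations; $\omega := \omega(1,1,1)$. *)

theory Defs
  imports
    "HOL-Library.Poly_Mapping"
    "HOL-Library.Nat_Bijection"
    "HOL-Library.Landau_Symbols"
    "HOL-Computational_Algebra.Fraction_Field"
    "Jordan_Normal_Form.Matrix"
    "Jordan_Normal_Form.DL_Rank"
begin

text \<open>
  Arithmetic operations are counted in the standard model of algebraic complexity theory:
  straight-line computations over the field \<open>F(x\<^sub>0, x\<^sub>1, \<dots>)\<close> of rational functions, whose inputs
  are indeterminates.  Scalars from \<open>F\<close> are available for free; each addition, subtraction,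
  multiplication and division costs one.  Working with indeterminates rather than with functions
  on \<open>F\<close> matters for finite \<open>F\<close>, where distinct polynomials may agree as functions.
\<close>

inductive straight_line :: "'k::field set \<Rightarrow> 'k list \<Rightarrow> bool"
  for S :: "'k set"
where
  empty: "straight_line S []"
| step: "\<lbrakk>straight_line S gs; u \<in> S \<union> set gs; v \<in> S \<union> set gs;
          g = u + v \<or> g = u - v \<or> g = u * v \<or> (v \<noteq> 0 \<and> g = u / v)\<rbrakk>
         \<Longrightarrow> straight_line S (gs @ [g])"

definition computable_in :: "'k::field set \<Rightarrow> 'k set \<Rightarrow> nat \<Rightarrow> bool" where
  "computable_in S Y s \<longleftrightarrow>
     (\<exists>gs. straight_line S gs \<and> length gs \<le> s \<and> Y \<subseteq> S \<union> set gs)"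

type_synonym 'f ratfun = "((nat \<Rightarrow>\<^sub>0 nat) \<Rightarrow>\<^sub>0 'f) fract"

definition rf_const :: "'f::field \<Rightarrow> 'f ratfun" where
  "rf_const c = Fract (Poly_Mapping.single 0 c) 1"

definition rf_var :: "nat \<Rightarrow> 'f::field ratfun" where
  "rf_var v = Fract (Poly_Mapping.single (Poly_Mapping.single v 1) 1) 1"

text \<open>Two generic matrices whose entries are pairwise distinct indeterminates: those of the left
  factor have even index, those of the right factor odd index.\<close>

definition generic_left :: "nat \<Rightarrow> nat \<Rightarrow> 'f::field ratfun mat" where
  "generic_left p q = mat p q (\<lambda>ij. rf_var (2 * prod_encode ij))"

definition generic_right :: "nat \<Rightarrow> nat \<Rightarrow> 'f::field ratfun mat" where
  "generic_right q r = mat q r (\<lambda>jk. rf_var (2 * prod_encode jk + 1))"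

definition matmul_in :: "'f::field itself \<Rightarrow> nat \<Rightarrow> nat \<Rightarrow> nat \<Rightarrow> nat \<Rightarrow> bool" where
  "matmul_in _ p q r s \<longleftrightarrow>
     computable_in
       (range (rf_const :: 'f \<Rightarrow> 'f ratfun)
          \<union> elements_mat (generic_left p q) \<union> elements_mat (generic_right q r))
       (elements_mat (generic_left p q * generic_right q r)) s"

text \<open>Dimensions \<open>n\<^sup>a\<close> are rounded down to integers.\<close>

definition dim_pow :: "nat \<Rightarrow> real \<Rightarrow> nat" where
  "dim_pow n a = nat \<lfloor>real n powr a\<rfloor>"

definition omega_rect :: "'f::field itself \<Rightarrow> real \<Rightarrow> real \<Rightarrow> real \<Rightarrow> real" where
  "omega_rect F a b c = Inf {w. w > 0 \<and>
     (\<exists>s :: nat \<Rightarrow> nat. (\<lambda>n. real (s n)) \<in> O(\<lambda>n. real n powr w) \<and>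
        (\<forall>n. matmul_in F (dim_pow n a) (dim_pow n b) (dim_pow n c) (s n)))}"

definition omega :: "'f::field itself \<Rightarrow> real" where
  "omega F = omega_rect F 1 1 1"

end

theory Submission
  imports Defs "Jordan_Normal_Form.Determinant"
begin

text \<open>
  Taking \<open>B = 1\<close>, the hypothesis says that \<open>M \<mapsto> (L\<^sub>i M R\<^sub>i)\<^sub>i\<close> is injective, which
  gives the first inequality by counting dimensions, and a linear left inverse. With the left inverse,
  a multiplication of format \<open>(n P, Q, n T)\<close> reduces to multiplications of formats
  \<open>(p\<^sub>i P, Q, q\<^sub>i T)\<close>, where \<open>p\<^sub>i = n\<close> to the \<open>\<alpha>\<^sub>i\<close> and \<open>q\<^sub>i = n\<close> to the \<open>\<beta>\<^sub>i\<close>. Iterating this \<open>m\<close> times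
  and collecting equal factors, the tensor rank of format \<open>(n\<^sup>m, n\<^sup>m, n\<^sup>m)\<close> is at most \<open>C S\<^sup>m\<close>
  with \<open>S\<close> arbitrarily close to the sum in the last inequality, and \<open>m \<rightarrow> \<infinity>\<close> removes \<open>C\<close>.

  Divisions make it impossible to substitute values for inputs of a straight-line program
  over a finite field, so operation counts are compared through tensor rank. A program of size \<open>s\<close>
  bounds the rank over the field \<open>K\<close> of rational functions by \<open>2 s\<close>: the matrices of mixed
  derivatives of its results lie in the span of \<open>2 s\<close> rank-one matrices over \<open>K\<close>. The rank over \<open>K\<close>
  descends to the base field at a subexponential price, because the coefficients of a \<open>t\<close>-th tensor power are
  monomials of degree \<open>t\<close> in finitely many elements of \<open>K\<close>, of which there are only polynomially many
  in \<open>t\<close>. Monotonicity and symmetry of the rank also give the second inequality.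
\<close>

section \<open>Rank decompositions of the matrix multiplication tensor\<close>

text \<open>The set \<open>E\<close> confines the coefficients of the decomposition: finiteness of \<open>E\<close> drives the
  descent to the base field, and \<open>E\<close> consisting of scalars makes the coefficients free in a
  straight-line program.\<close>

definition mm_decomp_by ::
    "'a::field set \<Rightarrow> 'i set \<Rightarrow> 'j set \<Rightarrow> 'k set \<Rightarrow> 'l set \<Rightarrow>
     ('l \<Rightarrow> 'i \<Rightarrow> 'j \<Rightarrow> 'a) \<Rightarrow> ('l \<Rightarrow> 'j \<Rightarrow> 'k \<Rightarrow> 'a) \<Rightarrow> ('l \<Rightarrow> 'i \<Rightarrow> 'k \<Rightarrow> 'a) \<Rightarrow> bool" where
  "mm_decomp_by E I J K \<Lambda> f g h \<longleftrightarrow>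
     (\<forall>l\<in>\<Lambda>. \<forall>i\<in>I. \<forall>j\<in>J. f l i j \<in> E) \<and>
     (\<forall>l\<in>\<Lambda>. \<forall>j\<in>J. \<forall>k\<in>K. g l j k \<in> E) \<and>
     (\<forall>l\<in>\<Lambda>. \<forall>i\<in>I. \<forall>k\<in>K. h l i k \<in> E) \<and>
     (\<forall>i\<in>I. \<forall>j\<in>J. \<forall>j'\<in>J. \<forall>k\<in>K. \<forall>i'\<in>I. \<forall>k'\<in>K.
        (\<Sum>l\<in>\<Lambda>. f l i j * g l j' k * h l i' k') = of_bool (i = i' \<and> j = j' \<and> k = k'))"

definition mm_decomp ::
    "'a::field set \<Rightarrow> 'i set \<Rightarrow> 'j set \<Rightarrow> 'k set \<Rightarrow> nat \<Rightarrow> bool" where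
  "mm_decomp E I J K R \<longleftrightarrow> (\<exists>f g h. mm_decomp_by E I J K {..<R} f g h)"

abbreviation mm_dims :: "'a::field set \<Rightarrow> nat \<Rightarrow> nat \<Rightarrow> nat \<Rightarrow> nat \<Rightarrow> bool" where
  "mm_dims E p q r R \<equiv> mm_decomp E {..<p} {..<q} {..<r} R"

lemma mm_decomp_by_eq:
  assumes "mm_decomp_by E I J K \<Lambda> f g h"
    and "i \<in> I" "j \<in> J" "j' \<in> J" "k \<in> K" "i' \<in> I" "k' \<in> K"
  shows "(\<Sum>l\<in>\<Lambda>. f l i j * g l j' k * h l i' k') = of_bool (i = i' \<and> j = j' \<and> k = k')"
  using assms unfolding mm_decomp_by_def by blast

lemma mm_decomp_by_mem:
  assumes "mm_decomp_by E I J K \<Lambda> f g h" and "l \<in> \<Lambda>"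
  shows "i \<in> I \<Longrightarrow> j \<in> J \<Longrightarrow> f l i j \<in> E" "j \<in> J \<Longrightarrow> k \<in> K \<Longrightarrow> g l j k \<in> E" "i \<in> I \<Longrightarrow> k \<in> K \<Longrightarrow> h l i k \<in> E"
  using assms unfolding mm_decomp_by_def by blast+

text \<open>The constructions below index their summands by products and dependent sums, so any
  finite index set of the right cardinality is accepted and renumbered by a bijection.\<close>

lemma mm_decompI:
  assumes fin: "finite \<Lambda>" and card: "card \<Lambda> = R"
    and f: "\<And>l i j. l \<in> \<Lambda> \<Longrightarrow> i \<in> I \<Longrightarrow> j \<in> J \<Longrightarrow> f l i j \<in> E"
    and g: "\<And>l j k. l \<in> \<Lambda> \<Longrightarrow> j \<in> J \<Longrightarrow> k \<in> K \<Longrightarrow> g l j k \<in> E"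
    and h: "\<And>l i k. l \<in> \<Lambda> \<Longrightarrow> i \<in> I \<Longrightarrow> k \<in> K \<Longrightarrow> h l i k \<in> E"
    and eq: "\<And>i j j' k i' k'. i \<in> I \<Longrightarrow> j \<in> J \<Longrightarrow> j' \<in> J \<Longrightarrow> k \<in> K \<Longrightarrow> i' \<in> I \<Longrightarrow> k' \<in> K \<Longrightarrow>
        (\<Sum>l\<in>\<Lambda>. f l i j * g l j' k * h l i' k') = of_bool (i = i' \<and> j = j' \<and> k = k')"
  shows "mm_decomp E I J K R"
proof -
  obtain b where b: "bij_betw b {..<R} \<Lambda>"
    using ex_bij_betw_nat_finite[OF fin] card by (auto simp: lessThan_atLeast0)
  have bin: "b l \<in> \<Lambda>" if "l < R" for l
    using bij_betwE[OF b] that by auto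
  have "(\<Sum>l<R. f (b l) i j * g (b l) j' k * h (b l) i' k')
      = (\<Sum>l\<in>\<Lambda>. f l i j * g l j' k * h l i' k')" for i j j' k i' k'
    by (rule sum.reindex_bij_betw[OF b])
  then show ?thesis
    unfolding mm_decomp_def mm_decomp_by_def
    by (intro exI[of _ "\<lambda>l. f (b l)"] exI[of _ "\<lambda>l. g (b l)"] exI[of _ "\<lambda>l. h (b l)"])
       (simp add: f g h eq bin)
qed

lemma mm_decomp_reindex:
  assumes d: "mm_decomp E I J K R"
    and a: "inj_on a I'" "a ` I' \<subseteq> I"
    and b: "inj_on b J'" "b ` J' \<subseteq> J"
    and c: "inj_on c K'" "c ` K' \<subseteq> K"
  shows "mm_decomp E I' J' K' R"
proof -
  from d obtain f g h where D: "mm_decomp_by E I J K {..<R} f g h"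
    unfolding mm_decomp_def by blast
  note fgh = mm_decomp_by_mem[OF D] and eq = mm_decomp_by_eq[OF D]
  have aI: "i \<in> I' \<Longrightarrow> a i \<in> I" and bJ: "j \<in> J' \<Longrightarrow> b j \<in> J" and cK: "k \<in> K' \<Longrightarrow> c k \<in> K" for i j k
    using a b c by auto
  show ?thesis
    by (rule mm_decompI[where \<Lambda> = "{..<R}" and f = "\<lambda>l i j. f l (a i) (b j)"
          and g = "\<lambda>l j k. g l (b j) (c k)" and h = "\<lambda>l i k. h l (a i) (c k)"])
       (simp_all add: fgh eq aI bJ cK inj_on_eq_iff[OF a(1)] inj_on_eq_iff[OF b(1)] inj_on_eq_iff[OF c(1)])
qed

text \<open>Only the sizes of the index sets matter, because a decomposition restricts along
  injections. This covers monotonicity as well as the passage between product index sets and initial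
  segments.\<close>

lemma mm_decomp_card_le:
  assumes d: "mm_decomp E I J K R"
    and fin: "finite I" "finite J" "finite K" "finite I'" "finite J'" "finite K'"
    and le: "card I' \<le> card I" "card J' \<le> card J" "card K' \<le> card K"
  shows "mm_decomp E I' J' K' R"
proof -
  obtain a where a: "inj_on a I'" "a ` I' \<subseteq> I"
    using card_le_inj[OF fin(4,1) le(1)] by auto
  obtain b where b: "inj_on b J'" "b ` J' \<subseteq> J"
    using card_le_inj[OF fin(5,2) le(2)] by auto
  obtain c where c: "inj_on c K'" "c ` K' \<subseteq> K"
    using card_le_inj[OF fin(6,3) le(3)] by auto
  show ?thesis
    by (rule mm_decomp_reindex[OF d a b c])
qed

lemma mm_dims_mono:
  assumes "mm_dims E p q r R" "p' \<le> p" "q' \<le> q" "r' \<le> r"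
  shows "mm_dims E p' q' r' R"
  by (rule mm_decomp_card_le[OF assms(1)]) (use assms in auto)

text \<open>Since \<open>(A B)^T = B^T A^T\<close>, the roles of \<open>f\<close> and
  \<open>g\<close> are exchanged and all three families are transposed.\<close>

lemma mm_decomp_transpose:
  assumes d: "mm_decomp E I J K R"
  shows "mm_decomp E K J I R"
proof -
  from d obtain f g h where D: "mm_decomp_by E I J K {..<R} f g h"
    unfolding mm_decomp_def by blast
  note fgh = mm_decomp_by_mem[OF D] and eq = mm_decomp_by_eq[OF D]
  have eq_T: "(\<Sum>l<R. g l j i * f l k j' * h l k' i') = of_bool (i = i' \<and> j = j' \<and> k = k')"
    if "i \<in> K" "j \<in> J" "j' \<in> J" "k \<in> I" "i' \<in> K" "k' \<in> I" for i j j' k i' k'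
    using eq[of k j' j i k' i'] that by (auto simp: mult.commute)
  show ?thesis
    by (rule mm_decompI[where \<Lambda> = "{..<R}" and f = "\<lambda>l i j. g l j i"
          and g = "\<lambda>l j k. f l k j" and h = "\<lambda>l i k. h l k i"])
       (simp_all add: fgh eq_T)
qed

text \<open>The Kronecker product of two decompositions: a sum over pairs of summands factors into
  the two original sums.\<close>

lemma mm_decomp_Times:
  assumes d: "mm_decomp E I J K R" and d': "mm_decomp E' I' J' K' R'"
  shows "mm_decomp ((\<lambda>(x, y). x * y) ` (E \<times> E')) (I \<times> I') (J \<times> J') (K \<times> K') (R * R')"
proof -
  from d obtain f g h where D: "mm_decomp_by E I J K {..<R} f g h"
    unfolding mm_decomp_def by blast
  note fgh = mm_decomp_by_mem[OF D] and eq = mm_decomp_by_eq[OF D]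
  from d' obtain f' g' h' where D': "mm_decomp_by E' I' J' K' {..<R'} f' g' h'"
    unfolding mm_decomp_def by blast
  note fgh' = mm_decomp_by_mem[OF D'] and eq' = mm_decomp_by_eq[OF D']
  have mem: "x * y \<in> (\<lambda>(x, y). x * y) ` (E \<times> E')" if "x \<in> E" "y \<in> E'" for x y
    using that by force
  let ?f = "\<lambda>(l, l') (i, i') (j, j'). f l i j * f' l' i' j'"
  let ?g = "\<lambda>(l, l') (i, i') (j, j'). g l i j * g' l' i' j'"
  let ?h = "\<lambda>(l, l') (i, i') (j, j'). h l i j * h' l' i' j'"
  show ?thesis
  proof (rule mm_decompI[where \<Lambda> = "{..<R} \<times> {..<R'}" and f = ?f and g = ?g and h = ?h])
    fix i j j' k i' k'
    assume "i \<in> I \<times> I'" "j \<in> J \<times> J'" "j' \<in> J \<times> J'" "k \<in> K \<times> K'" "i' \<in> I \<times> I'" "k' \<in> K \<times> K'"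
    moreover obtain i1 i2 where "i = (i1, i2)" by (cases i)
    moreover obtain j1 j2 where "j = (j1, j2)" by (cases j)
    moreover obtain k1 k2 where "k = (k1, k2)" by (cases k)
    moreover obtain i1' i2' where "i' = (i1', i2')" by (cases i')
    moreover obtain j1' j2' where "j' = (j1', j2')" by (cases j')
    moreover obtain k1' k2' where "k' = (k1', k2')" by (cases k')
    moreover have "(\<Sum>l\<in>{..<R} \<times> {..<R'}. ?f l (i1, i2) (j1, j2) * ?g l (j1', j2') (k1, k2) * ?h l (i1', i2') (k1', k2'))
      = (\<Sum>l<R. f l i1 j1 * g l j1' k1 * h l i1' k1') * (\<Sum>l<R'. f' l i2 j2 * g' l j2' k2 * h' l i2' k2')"
      unfolding sum_product sum.cartesian_product
      by (rule sum.cong) (auto simp: mult_ac)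
    ultimately show "(\<Sum>l\<in>{..<R} \<times> {..<R'}. ?f l i j * ?g l j' k * ?h l i' k')
       = of_bool (i = i' \<and> j = j' \<and> k = k')"
      by (simp add: eq eq' split: if_splits)
  qed (auto intro!: mem fgh fgh')
qed

lemma mm_dims_mult:
  assumes "mm_dims E p q r R" "mm_dims E' p' q' r' R'"
  shows "mm_dims ((\<lambda>(x, y). x * y) ` (E \<times> E')) (p * p') (q * q') (r * r') (R * R')"
  by (rule mm_decomp_card_le[OF mm_decomp_Times[OF assms]]) auto

lemma mm_decomp_subset:
  assumes "mm_decomp E I J K R" "E \<subseteq> E'"
  shows "mm_decomp E' I J K R"
  proof -
  obtain f g h where "mm_decomp_by E I J K {..<R} f g h"
    using assms(1) unfolding mm_decomp_def by blast
  then have "mm_decomp_by E' I J K {..<R} f g h"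
    using assms(2) unfolding mm_decomp_by_def by blast
  then show ?thesis
    unfolding mm_decomp_def by blast
qed

lemma mm_dims_mult_UNIV:
  assumes "mm_dims (UNIV :: 'a::field set) p q r R" "mm_dims (UNIV :: 'a set) p' q' r' R'"
  shows "mm_dims (UNIV :: 'a set) (p * p') (q * q') (r * r') (R * R')"
  using mm_dims_mult[OF assms] by (rule mm_decomp_subset) simp

lemma mm_dims_1: "mm_dims {1} 1 1 1 1"
  by (rule mm_decompI[where \<Lambda> = "{0::nat}" and f = "\<lambda>_ _ _. 1" and g = "\<lambda>_ _ _. 1" and h = "\<lambda>_ _ _. 1"])
     auto

text \<open>The equations to be preserved have right-hand sides 0 and 1. Applied to
  \<open>rf_const\<close>, this turns the coefficients into scalars that are free in a straight-line
  program.\<close>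

lemma mm_decomp_map:
  assumes d: "mm_decomp E I J K R"
    and \<phi>: "\<phi> 0 = 0" "\<phi> 1 = 1" "\<And>x y. \<phi> (x + y) = \<phi> x + \<phi> y" "\<And>x y. \<phi> (x * y) = \<phi> x * \<phi> y"
  shows "mm_decomp (\<phi> ` E) I J K R"
proof -
  from d obtain f g h where D: "mm_decomp_by E I J K {..<R} f g h"
    unfolding mm_decomp_def by blast
  note fgh = mm_decomp_by_mem[OF D] and eq = mm_decomp_by_eq[OF D]
  have sum: "\<phi> (sum t A) = (\<Sum>x\<in>A. \<phi> (t x))" for t and A :: "nat set"
    by (induction A rule: infinite_finite_induct) (simp_all add: \<phi>)
  show ?thesis
  proof (rule mm_decompI[where \<Lambda> = "{..<R}" and f = "\<lambda>l i j. \<phi> (f l i j)"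
          and g = "\<lambda>l i j. \<phi> (g l i j)" and h = "\<lambda>l i j. \<phi> (h l i j)"])
    fix i j j' k i' k'
    assume "i \<in> I" "j \<in> J" "j' \<in> J" "k \<in> K" "i' \<in> I" "k' \<in> K"
    then show "(\<Sum>l<R. \<phi> (f l i j) * \<phi> (g l j' k) * \<phi> (h l i' k')) = of_bool (i = i' \<and> j = j' \<and> k = k')"
      using arg_cong[OF eq[of i j j' k i' k'], of \<phi>] by (simp add: sum \<phi> of_bool_def split: if_splits)
  qed (auto simp: fgh)
qed

section \<open>Lower bounds on ranks and dimensions by biorthogonal families\<close>

text \<open>Otherwise the identity matrix of size \<open>card A\<close> would factor through the
  smaller dimension \<open>card B\<close>.\<close>

lemma biorthogonal_card_le:
  fixes X :: "'b \<Rightarrow> 'c \<Rightarrow> 'a::field"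
  assumes finA: "finite A" and finB: "finite B"
    and XY: "\<And>a b. a \<in> A \<Longrightarrow> b \<in> A \<Longrightarrow> (\<Sum>l\<in>B. X a l * Y l b) = of_bool (a = b)"
  shows "card A \<le> card B"
proof (rule ccontr)
  assume less: "\<not> card A \<le> card B"
  define n where "n = card A"
  define m where "m = card B"
  have mn: "m < n" using less by (simp add: n_def m_def)
  obtain \<alpha> where \<alpha>: "bij_betw \<alpha> {..<n} A"
    using ex_bij_betw_nat_finite[OF finA] by (auto simp: n_def lessThan_atLeast0)
  obtain \<beta> where \<beta>: "bij_betw \<beta> {..<m} B"
    using ex_bij_betw_nat_finite[OF finB] by (auto simp: m_def lessThan_atLeast0)
  \<comment> \<open>Zero padding makes both factors square, so that a right inverse is also a left
    inverse; but row \<open>m\<close> of \<open>Q\<close> is zero, which contradicts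
    \<open>Q * P = 1\<close>.\<close>
  define P where "P = mat n n (\<lambda>(i, l). if l < m then X (\<alpha> i) (\<beta> l) else 0)"
  define Q where "Q = mat n n (\<lambda>(l, i). if l < m then Y (\<beta> l) (\<alpha> i) else 0)"
  have "P * Q = 1\<^sub>m n"
  proof (rule eq_matI)
    fix i j assume ij: "i < dim_row (1\<^sub>m n :: 'a mat)" "j < dim_col (1\<^sub>m n :: 'a mat)"
    have "(P * Q) $$ (i, j)
      = (\<Sum>l<n. (if l < m then X (\<alpha> i) (\<beta> l) else 0) * (if l < m then Y (\<beta> l) (\<alpha> j) else 0))"
      using ij by (simp add: P_def Q_def scalar_prod_def lessThan_atLeast0)
    also have "\<dots> = (\<Sum>l<m. X (\<alpha> i) (\<beta> l) * Y (\<beta> l) (\<alpha> j))"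
      by (rule sum.mono_neutral_cong_right) (use mn in auto)
    also have "\<dots> = (\<Sum>l\<in>B. X (\<alpha> i) l * Y l (\<alpha> j))"
      by (rule sum.reindex_bij_betw[OF \<beta>])
    also have "\<dots> = of_bool (\<alpha> i = \<alpha> j)"
      using ij bij_betwE[OF \<alpha>] by (intro XY) auto
    also have "\<dots> = of_bool (i = j)"
      using ij inj_on_eq_iff[OF bij_betw_imp_inj_on[OF \<alpha>], of i j] by simp
    finally show "(P * Q) $$ (i, j) = 1\<^sub>m n $$ (i, j)"
      using ij by simp
  qed (simp_all add: P_def Q_def)
  then have "Q * P = 1\<^sub>m n"
    by (rule mat_mult_left_right_inverse[rotated 2]) (simp_all add: P_def Q_def)
  then have "(Q * P) $$ (m, m) = 1"
    using mn by simp
  moreover have "(Q * P) $$ (m, m) = 0"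
    using mn by (simp add: P_def Q_def scalar_prod_def)
  ultimately show False by simp
qed

text \<open>With the index of one dimension frozen at 0, which positivity allows, the defining
  equation says that one of the three families is biorthogonal to the product of the other
  two.\<close>

lemma mm_dims_rank_ge:
  fixes E :: "'a::field set"
  assumes d: "mm_dims E p q r R" and pos: "p > 0" "q > 0" "r > 0"
  shows "p * q \<le> R" "q * r \<le> R" "p * r \<le> R"
proof -
  from d obtain f g h where D: "mm_decomp_by E {..<p} {..<q} {..<r} {..<R} f g h"
    unfolding mm_decomp_def by blast
  note eq = mm_decomp_by_eq[OF D]
  have "card ({..<p} \<times> {..<q}) \<le> card {..<R}"
    by (rule biorthogonal_card_le[where X = "\<lambda>a l. f l (fst a) (snd a)"
          and Y = "\<lambda>l b. g l (snd b) 0 * h l (fst b) 0"])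
       (use pos eq in \<open>auto simp flip: mult.assoc\<close>)
  then show "p * q \<le> R" by simp
  have "card ({..<q} \<times> {..<r}) \<le> card {..<R}"
  proof (rule biorthogonal_card_le[where X = "\<lambda>a l. g l (fst a) (snd a)"
          and Y = "\<lambda>l b. f l 0 (fst b) * h l 0 (snd b)"])
    fix a b assume "a \<in> {..<q} \<times> {..<r}" "b \<in> {..<q} \<times> {..<r}"
    then have "(\<Sum>l<R. f l 0 (fst b) * g l (fst a) (snd a) * h l 0 (snd b)) = of_bool (a = b)"
      using pos by (subst eq) (auto simp: prod_eq_iff)
    then show "(\<Sum>l<R. g l (fst a) (snd a) * (f l 0 (fst b) * h l 0 (snd b))) = of_bool (a = b)"
      by (simp add: mult_ac)
  qed auto
  then show "q * r \<le> R" by simp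
  have "card ({..<p} \<times> {..<r}) \<le> card {..<R}"
    by (rule biorthogonal_card_le[where X = "\<lambda>a l. f l (fst a) 0 * g l 0 (snd a)"
          and Y = "\<lambda>l b. h l (fst b) (snd b)"])
       (use pos eq in auto)
  then show "p * r \<le> R" by simp
qed

section \<open>From straight-line programs to rank decompositions\<close>

definition derivation :: "('a::comm_ring_1 \<Rightarrow> 'a) \<Rightarrow> bool" where
  "derivation D \<longleftrightarrow> (\<forall>x y. D (x + y) = D x + D y) \<and> (\<forall>x y. D (x * y) = x * D y + y * D x)"

lemma derivation_add: "derivation D \<Longrightarrow> D (x + y) = D x + D y"
  and derivation_mult: "derivation D \<Longrightarrow> D (x * y) = x * D y + y * D x"
  unfolding derivation_def by blast+

lemma derivation_0 [simp]: "derivation D \<Longrightarrow> D 0 = 0"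
  using derivation_add[of D 0 0] by simp

lemma derivation_1 [simp]: "derivation D \<Longrightarrow> D 1 = 0"
  using derivation_mult[of D 1 1] by simp

lemma derivation_diff: "derivation D \<Longrightarrow> D (x - y) = D x - D y"
  using derivation_add[of D "x - y" y] by (simp add: algebra_simps)

lemma derivation_sum: "derivation D \<Longrightarrow> D (sum t A) = (\<Sum>x\<in>A. D (t x))"
  by (induction A rule: infinite_finite_induct) (simp_all add: derivation_add)

lemma derivation_scale: "derivation D \<Longrightarrow> derivation (\<lambda>x. c * D x)"
  unfolding derivation_def by (auto simp: algebra_simps)

text \<open>The quotient rule forces the extension. Its value is read off a chosen representative,
  so the work lies in showing that every representative gives the same value; this follows by
  differentiating the cross-multiplied equation.\<close>

lemma derivation_fract_exists:
  fixes d :: "'a::idom \<Rightarrow> 'a"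
  assumes d: "derivation d"
  shows "\<exists>D. derivation D \<and> (\<forall>a. D (Fract a 1) = Fract (d a) 1)"
proof -
  define q where "q x = (SOME ab. snd ab \<noteq> 0 \<and> x = Fract (fst ab) (snd ab))" for x :: "'a fract"
  define D where "D x = (case q x of (a, b) \<Rightarrow> Fract (b * d a - a * d b) (b * b))" for x
  have D: "D (Fract a b) = Fract (b * d a - a * d b) (b * b)" if b: "b \<noteq> 0" for a b
  proof -
    obtain a' b' where q: "q (Fract a b) = (a', b')" by (cases "q (Fract a b)")
    have "\<exists>ab. snd ab \<noteq> 0 \<and> Fract a b = Fract (fst ab) (snd ab)"
      using b by (intro exI[of _ "(a, b)"]) simp
    from someI_ex[OF this] have b': "b' \<noteq> 0" and eq: "Fract a b = Fract a' b'"
      using q by (simp_all add: q_def)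
    from eq b b' have ab: "a * b' = a' * b" by (simp add: eq_fract)
    then have "d (a * b') = d (a' * b)" by simp
    then have dab: "a * d b' + b' * d a = a' * d b + b * d a'"
      by (simp add: derivation_mult[OF d])
    have "(b' * d a' - a' * d b') * (b * b) = b' * b * (b * d a') - (a' * b) * (b * d b')"
      by (simp add: algebra_simps)
    also have "b * d a' = a * d b' + b' * d a - a' * d b"
      using dab by (simp add: algebra_simps)
    also have "b' * b * (a * d b' + b' * d a - a' * d b) - (a' * b) * (b * d b')
      = b' * b * (a * d b' + b' * d a) - (a' * b) * b' * d b - (a' * b) * b * d b'"
      by (simp add: algebra_simps)
    also have "\<dots> = (b * d a - a * d b) * (b' * b')"
      unfolding ab[symmetric] by (simp add: algebra_simps)
    finally show ?thesis
      using b b' by (simp add: D_def q eq_fract)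
  qed
  have "derivation D"
    unfolding derivation_def
  proof (intro conjI allI)
    fix x y :: "'a fract"
    obtain a b where x: "x = Fract a b" "b \<noteq> 0" by (cases x)
    obtain a' b' where y: "y = Fract a' b'" "b' \<noteq> 0" by (cases y)
    show "D (x + y) = D x + D y"
      using x y by (simp add: D eq_fract derivation_mult[OF d] derivation_add[OF d]) (simp add: algebra_simps)
    show "D (x * y) = x * D y + y * D x"
      using x y by (simp add: D eq_fract derivation_mult[OF d] derivation_add[OF d]) (simp add: algebra_simps)
  qed
  moreover have "D (Fract a 1) = Fract (d a) 1" for a
    by (simp add: D d)
  ultimately show ?thesis by blast
qed

text \<open>The Euler operator \<open>x\<^sub>v \<partial>/\<partial>x\<^sub>v\<close> only scales monomials; dividing by \<open>x\<^sub>v\<close> in the field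
  of rational functions recovers the partial derivative without subtracting exponents.\<close>

lift_definition euler_deriv :: "'v \<Rightarrow> (('v \<Rightarrow>\<^sub>0 nat) \<Rightarrow>\<^sub>0 'a::comm_ring_1) \<Rightarrow> ('v \<Rightarrow>\<^sub>0 nat) \<Rightarrow>\<^sub>0 'a"
  is "\<lambda>v p m. of_nat (Poly_Mapping.lookup m v) * p m"
  by (rule finite_subset[rotated]) auto

lemma euler_deriv_single:
  "euler_deriv v (Poly_Mapping.single m c) = Poly_Mapping.single m (of_nat (Poly_Mapping.lookup m v) * c)"
  by transfer (auto simp: fun_eq_iff when_def)

lemma euler_deriv_add: "euler_deriv v (p + q) = euler_deriv v p + euler_deriv v q"
  by transfer (auto simp: fun_eq_iff algebra_simps)

lemma poly_mapping_induct_monomials [case_names single add]: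
  fixes p :: "'a \<Rightarrow>\<^sub>0 'b::comm_monoid_add"
  assumes "\<And>m c. P (Poly_Mapping.single m c)" and "\<And>p q. P p \<Longrightarrow> P q \<Longrightarrow> P (p + q)"
  shows "P p"
proof -
  have "P (\<Sum>m\<in>A. Poly_Mapping.single m (Poly_Mapping.lookup p m))" if "finite A" for A
    using that assms(1)[of _ 0] by (induction A) (auto intro: assms)
  moreover have "p = (\<Sum>m\<in>Poly_Mapping.keys p. Poly_Mapping.single m (Poly_Mapping.lookup p m))"
    by (rule poly_mapping_eqI)
       (auto simp: lookup_sum lookup_single when_def sum.delta in_keys_iff)
  ultimately show ?thesis by (metis finite_keys)
qed

text \<open>Both sides of the Leibniz rule are additive in each argument, so monomials suffice;
  there it says that the exponents of \<open>v\<close> add under multiplication.\<close>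

lemma derivation_euler_deriv: "derivation (euler_deriv v)"
proof -
  have "euler_deriv v (p * q) = p * euler_deriv v q + q * euler_deriv v p" for p q :: "('a \<Rightarrow>\<^sub>0 nat) \<Rightarrow>\<^sub>0 'b"
  proof (induction p rule: poly_mapping_induct_monomials)
    case (single m c)
    show ?case
    proof (induction q rule: poly_mapping_induct_monomials)
      case (single m' c')
      show ?case
        by (simp add: mult_single euler_deriv_single lookup_add single_add[symmetric] algebra_simps)
    qed (simp add: euler_deriv_add algebra_simps)
  qed (simp add: euler_deriv_add algebra_simps)
  then show ?thesis
    unfolding derivation_def by (simp add: euler_deriv_add)
qed

lemma rf_var_nonzero: "rf_var v \<noteq> (0 :: 'f::field ratfun)"
proof
  assume "rf_var v = (0 :: 'f ratfun)"
  then have "Poly_Mapping.single (Poly_Mapping.single v (1::nat)) (1::'f) = 0"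
    unfolding rf_var_def Zero_fract_def by (simp add: eq_fract)
  then show False
    using lookup_single_eq[of "Poly_Mapping.single v (1::nat)" "1::'f"] by simp
qed

text \<open>The formal partial derivatives. They act on all rational functions over every field,
  whereas evaluation at points could meet a zero denominator.\<close>

lemma rf_derivations_exist:
  "\<exists>D :: nat \<Rightarrow> 'f::field ratfun \<Rightarrow> 'f ratfun.
     (\<forall>v. derivation (D v)) \<and> (\<forall>v c. D v (rf_const c) = 0) \<and>
     (\<forall>v u. D v (rf_var u) = of_bool (u = v))"
proof -
  obtain E :: "nat \<Rightarrow> 'f ratfun \<Rightarrow> 'f ratfun"
    where E: "\<And>v. derivation (E v)" "\<And>v a. E v (Fract a 1) = Fract (euler_deriv v a) 1"
    using derivation_fract_exists[OF derivation_euler_deriv] by metis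
  define D where "D v x = inverse (rf_var v) * E v x" for v x
  have "derivation (D v)" for v
    unfolding D_def using E(1) by (rule derivation_scale)
  moreover have "D v (rf_const c) = 0" for v c
    by (simp add: D_def rf_const_def E euler_deriv_single Zero_fract_def)
  moreover have "D v (rf_var u) = of_bool (u = v)" for v u
  proof -
    have "E v (rf_var u) = of_bool (u = v) * rf_var u"
      by (simp add: rf_var_def E euler_deriv_single lookup_single when_def Zero_fract_def)
    then show ?thesis
      using rf_var_nonzero[where 'f = 'f, of v] by (simp add: D_def)
  qed
  ultimately show ?thesis by blast
qed

text \<open>For a product, the matrix of mixed derivatives changes by a linear combination and two rank-one
  matrices; reading \<open>u = (u / v) * v\<close> backwards gives the same for a quotient.\<close>

lemma straight_line_mixed_derivatives:
  fixes D D' :: "'v \<Rightarrow> 'k::field \<Rightarrow> 'k"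
  assumes der: "\<And>u. derivation (D u)" "\<And>u. derivation (D' u)"
    and S: "\<And>u v x. x \<in> S \<Longrightarrow> D u (D' v x) = 0"
    and sl: "straight_line S gs"
  shows "\<exists>f g. \<forall>x\<in>S \<union> set gs. \<exists>h. \<forall>u v.
           D u (D' v x) = (\<Sum>l<2 * length gs. f l u * g l v * h l)"
  using sl
proof (induction rule: straight_line.induct)
  case empty
  then show ?case using S by simp
next
  case (step gs a b x)
  \<comment> \<open>The families \<open>f\<close> and \<open>g\<close> are shared by all results so
    far; only the weights \<open>h\<close> depend on the result.\<close>
  from step.IH obtain f g where
    IH: "\<And>y. y \<in> S \<union> set gs \<Longrightarrow> \<exists>h. \<forall>u v. D u (D' v y) = (\<Sum>l<2 * length gs. f l u * g l v * h l)"
    by blast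
  let ?n = "2 * length gs"
  obtain ha where ha: "\<And>u v. D u (D' v a) = (\<Sum>l<?n. f l u * g l v * ha l)"
    using IH[OF step.hyps(2)] by blast
  obtain hb where hb: "\<And>u v. D u (D' v b) = (\<Sum>l<?n. f l u * g l v * hb l)"
    using IH[OF step.hyps(3)] by blast
  have mix: "D u (D' v (y * z)) = y * D u (D' v z) + z * D u (D' v y) + D u y * D' v z + D u z * D' v y" for y z u v
    by (simp add: der derivation_mult derivation_add algebra_simps)
  \<comment> \<open>A product \<open>x = a * b\<close> contributes the outer products of the
    derivatives of \<open>a\<close> and \<open>b\<close>; a quotient, read as
    \<open>a = x * b\<close>, those of \<open>x\<close> and \<open>b\<close>. In both cases
    \<open>y\<close> is the partner of \<open>b\<close>, so two new summands suffice.\<close>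
  define y where "y = (if b \<noteq> 0 \<and> x = a / b then x else a)"
  define f' where "f' l = (if l < ?n then f l else if l = ?n then (\<lambda>u. D u y) else (\<lambda>u. D u b))" for l
  define g' where "g' l = (if l < ?n then g l else if l = ?n then (\<lambda>u. D' u b) else (\<lambda>u. D' u y))" for l
  have ext: "(\<Sum>l<2 * length (gs @ [x]). f' l u * g' l v * (if l < ?n then h l else c))
     = (\<Sum>l<?n. f l u * g l v * h l) + D u y * D' v b * c + D u b * D' v y * c" for u v h c
  proof -
    have "2 * length (gs @ [x]) = Suc (Suc ?n)" by simp
    then show ?thesis by (simp add: f'_def g'_def)
  qed
  have old: "\<exists>h. \<forall>u v. D u (D' v z) = (\<Sum>l<2 * length (gs @ [x]). f' l u * g' l v * h l)"
    if z: "z \<in> S \<union> set gs" for z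
  proof -
    obtain h where "\<And>u v. D u (D' v z) = (\<Sum>l<?n. f l u * g l v * h l)"
      using IH[OF z] by blast
    then show ?thesis
      by (intro exI[of _ "\<lambda>l. if l < ?n then h l else 0"] allI) (subst ext, simp)
  qed
  have new: "\<exists>h. \<forall>u v. D u (D' v x) = (\<Sum>l<2 * length (gs @ [x]). f' l u * g' l v * h l)"
  proof -
    consider "x = a + b" | "x = a - b" | "b \<noteq> 0" "x = a / b" | "x = a * b" "y = a"
      using step.hyps(4) unfolding y_def by presburger
    then show ?thesis
    proof cases
      case 1
      then show ?thesis
        by (intro exI[of _ "\<lambda>l. if l < ?n then ha l + hb l else 0"] allI)
           (subst ext, simp add: der derivation_add ha hb sum.distrib distrib_left)
    next
      case 2
      then show ?thesis
        by (intro exI[of _ "\<lambda>l. if l < ?n then ha l - hb l else 0"] allI)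
           (subst ext, simp add: der derivation_diff ha hb sum_subtractf right_diff_distrib)
    next
      case 3
      then have y: "y = x" and a: "a = x * b"
        by (simp_all add: y_def)
      have "D u (D' v x) = (\<Sum>l<?n. f l u * g l v * (inverse b * (ha l - x * hb l)))
          + D u y * D' v b * (- inverse b) + D u b * D' v y * (- inverse b)" for u v
      proof -
        have "b * D u (D' v x) = D u (D' v a) - x * D u (D' v b) - D u x * D' v b - D u b * D' v x"
          unfolding a mix by (simp add: algebra_simps)
        then have "D u (D' v x) = inverse b * (D u (D' v a) - x * D u (D' v b) - D u x * D' v b - D u b * D' v x)"
          using 3(1) by (simp add: nonzero_eq_divide_eq mult.commute flip: divide_inverse_commute)
        also have "\<dots> = inverse b * (\<Sum>l<?n. f l u * g l v * (ha l - x * hb l))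
            + D u y * D' v b * (- inverse b) + D u b * D' v y * (- inverse b)"
          unfolding ha hb y
          by (simp add: algebra_simps sum_subtractf sum_distrib_left)
        finally show ?thesis
          by (simp add: sum_distrib_left mult_ac)
      qed
      then show ?thesis
        by (intro exI[of _ "\<lambda>l. if l < ?n then inverse b * (ha l - x * hb l) else - inverse b"] allI)
           (subst ext, blast)
    next
      case 4
      have "D u (D' v x) = (\<Sum>l<?n. f l u * g l v * (a * hb l + b * ha l))
          + D u y * D' v b * 1 + D u b * D' v y * 1" for u v
        unfolding 4 mix ha hb by (simp add: algebra_simps sum.distrib sum_distrib_left)
      then show ?thesis
        by (intro exI[of _ "\<lambda>l. if l < ?n then a * hb l + b * ha l else 1"] allI)
           (subst ext, blast)
    qed
  qed
  show ?case
    by (rule exI[of _ f'], rule exI[of _ g']) (use old new in auto)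
qed

lemma generic_product_index:
  assumes "i < p" "k < r"
  shows "(generic_left p q * generic_right q r) $$ (i, k)
    = (\<Sum>j<q. rf_var (2 * prod_encode (i, j)) * rf_var (2 * prod_encode (j, k) + 1))"
  using assms by (simp add: generic_left_def generic_right_def scalar_prod_def lessThan_atLeast0)

text \<open>The mixed derivative of entry \<open>(i', k')\<close> of the generic product with
  respect to the indeterminates at \<open>(i, j)\<close> and \<open>(j', k)\<close> is 1 if the
  indices match and 0 otherwise, which is the multiplication tensor itself. The weights belonging to
  the entries become the third family.\<close>

lemma matmul_in_imp_mm_dims:
  assumes "matmul_in TYPE('f::field) p q r s"
  shows "\<exists>R\<le>2 * s. mm_dims (UNIV :: 'f ratfun set) p q r R"
proof -
  let ?S = "range (rf_const :: 'f \<Rightarrow> 'f ratfun)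
          \<union> elements_mat (generic_left p q) \<union> elements_mat (generic_right q r)"
  let ?x = "\<lambda>i j. rf_var (2 * prod_encode (i, j)) :: 'f ratfun"
  let ?y = "\<lambda>j k. rf_var (2 * prod_encode (j, k) + 1) :: 'f ratfun"
  obtain gs where gs: "straight_line ?S gs" "length gs \<le> s"
      "elements_mat (generic_left p q * generic_right q r) \<subseteq> ?S \<union> set gs"
    using assms unfolding matmul_in_def computable_in_def by blast
  obtain D :: "nat \<Rightarrow> 'f ratfun \<Rightarrow> 'f ratfun" where
    D: "\<And>v. derivation (D v)" "\<And>v c. D v (rf_const c) = 0" "\<And>v u. D v (rf_var u) = of_bool (u = v)"
    using rf_derivations_exist by blast
  \<comment> \<open>Inputs are scalars or indeterminates, so their first derivatives are 0 or 1 and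
    their second derivatives vanish.\<close>
  have DD: "D u (D v x) = 0" if "x \<in> ?S" for u v x
  proof -
    from that consider c where "x = rf_const c" | w where "x = rf_var w"
      by (auto simp: generic_left_def generic_right_def dest!: elements_matD)
    then show ?thesis
      by cases (auto simp: D of_bool_def)
  qed
  from straight_line_mixed_derivatives[where D = D and D' = D, OF D(1) D(1) DD gs(1)]
  obtain f g where fg: "\<And>x. x \<in> ?S \<union> set gs \<Longrightarrow>
      \<exists>h. \<forall>u v. D u (D v x) = (\<Sum>l<2 * length gs. f l u * g l v * h l)"
    by blast
  let ?P = "generic_left p q * generic_right q r :: 'f ratfun mat"
  have "\<exists>h. \<forall>u v. D u (D v (?P $$ (i, k))) = (\<Sum>l<2 * length gs. f l u * g l v * h l)"
    if "i < p" "k < r" for i k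
  proof (rule fg)
    have "?P $$ (i, k) \<in> elements_mat ?P"
      using that by (intro elements_matI[of _ p r]) (auto simp: generic_left_def generic_right_def)
    then show "?P $$ (i, k) \<in> ?S \<union> set gs" using gs(3) by blast
  qed
  note ex_h = this
  define h where "h i k = (SOME h. \<forall>u v. D u (D v (?P $$ (i, k))) = (\<Sum>l<2 * length gs. f l u * g l v * h l))" for i k
  have h: "D u (D v (?P $$ (i, k))) = (\<Sum>l<2 * length gs. f l u * g l v * h i k l)"
    if "i < p" "k < r" for i k u v
    using someI_ex[OF ex_h[OF that]] unfolding h_def by blast
  have "mm_dims (UNIV :: 'f ratfun set) p q r (2 * length gs)"
  proof (rule mm_decompI[where \<Lambda> = "{..<2 * length gs}"
        and f = "\<lambda>l i j. f l (2 * prod_encode (i, j))"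
        and g = "\<lambda>l j k. g l (2 * prod_encode (j, k) + 1)" and h = "\<lambda>l i k. h i k l"])
    fix i j j' k i' k'
    assume *: "i \<in> {..<p}" "j \<in> {..<q}" "j' \<in> {..<q}" "k \<in> {..<r}" "i' \<in> {..<p}" "k' \<in> {..<r}"
    let ?u = "2 * prod_encode (i, j)" and ?v = "2 * prod_encode (j', k) + 1"
    \<comment> \<open>Even and odd indices never meet, so differentiating by an entry of the right
      factor kills all entries of the left one.\<close>
    have ev: "2 * a \<noteq> 2 * b + 1" "2 * b + 1 \<noteq> 2 * a" for a b :: nat
      by presburger+
    have Dy: "D ?v (?y t k') = of_bool (t = j' \<and> k' = k)" for t
      by (simp add: D)
    have Dx: "D ?v (?x i' t) = 0" for t
      using ev by (simp add: D)
    have "D ?v (?P $$ (i', k')) = (\<Sum>t<q. of_bool (t = j' \<and> k' = k) * ?x i' t)"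
      using * by (simp only: generic_product_index lessThan_iff derivation_sum[OF D(1)] derivation_mult[OF D(1)] Dx Dy
          mult_zero_left mult_zero_right add_0_right mult.commute)
    also have "\<dots> = of_bool (k' = k) * ?x i' j'"
      using * by (auto simp: of_bool_def if_distrib if_distribR cong: if_cong)
    finally have "D ?u (D ?v (?P $$ (i', k'))) = of_bool (k' = k) * D ?u (?x i' j')"
      using D(1) by simp
    also have "\<dots> = of_bool (i = i' \<and> j = j' \<and> k = k')"
      by (auto simp: D)
    finally show "(\<Sum>l<2 * length gs. f l ?u * g l ?v * h i' k' l) = of_bool (i = i' \<and> j = j' \<and> k = k')"
      using h[of i' k'] * by simp
  qed auto
  then show ?thesis using gs(2) by (meson mult_le_mono2)
qed

section \<open>Descent of rank decompositions to the base field\<close>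

text \<open>For finite \<open>E\<close> this contains every product of \<open>t\<close> elements of
  \<open>E\<close>. Bounding each exponent by \<open>t\<close> instead of fixing the degree makes
  the polynomial bound on the cardinality immediate.\<close>

definition monomial_values :: "'a::comm_monoid_mult set \<Rightarrow> nat \<Rightarrow> 'a set" where
  "monomial_values E t = (\<lambda>c. \<Prod>x\<in>E. x ^ c x) ` (E \<rightarrow>\<^sub>E {..t})"

lemma finite_monomial_values: "finite E \<Longrightarrow> finite (monomial_values E t)"
  unfolding monomial_values_def by (intro finite_imageI finite_PiE) auto

lemma card_monomial_values_le:
  assumes "finite E"
  shows "card (monomial_values E t) \<le> (t + 1) ^ card E"
proof -
  have "card (monomial_values E t) \<le> card (E \<rightarrow>\<^sub>E {..t})"
    unfolding monomial_values_def using assms by (intro card_image_le finite_PiE) auto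
  then show ?thesis
    using assms by (simp add: card_PiE)
qed

lemma mult_mem_monomial_values:
  assumes fin: "finite E" and x: "x \<in> E" and y: "y \<in> monomial_values E t"
  shows "x * y \<in> monomial_values E (Suc t)"
proof -
  obtain c where c: "c \<in> E \<rightarrow>\<^sub>E {..t}" "y = (\<Prod>z\<in>E. z ^ c z)"
    using y unfolding monomial_values_def by blast
  have "(\<Prod>z\<in>E - {x}. z ^ (c(x := Suc (c x))) z) = (\<Prod>z\<in>E - {x}. z ^ c z)"
    by (rule prod.cong) auto
  then have "x * y = (\<Prod>z\<in>E. z ^ (c(x := Suc (c x))) z)"
    unfolding c(2) prod.remove[OF fin x, of "\<lambda>z. z ^ c z"]
      prod.remove[OF fin x, of "\<lambda>z. z ^ (c(x := Suc (c x))) z"]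
    by (simp add: mult.assoc)
  moreover have "c(x := Suc (c x)) \<in> E \<rightarrow>\<^sub>E {..Suc t}"
    using c(1) x by (auto simp: PiE_iff extensional_def le_Suc_eq)
  ultimately show ?thesis
    unfolding monomial_values_def by blast
qed

lemma mm_dims_power:
  assumes fin: "finite E" and d: "mm_dims E p q r R"
  shows "mm_dims (monomial_values E t) (p ^ t) (q ^ t) (r ^ t) (R ^ t)"
proof (induction t)
  case 0
  have "(1::'a) \<in> monomial_values E 0"
    unfolding monomial_values_def by (rule image_eqI[of _ _ "\<lambda>x\<in>E. 0"]) auto
  then show ?case
    using mm_decomp_subset[OF mm_dims_1] by auto
next
  case (Suc t)
  have "(\<lambda>(x, y). x * y) ` (E \<times> monomial_values E t) \<subseteq> monomial_values E (Suc t)"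
    using mult_mem_monomial_values[OF fin] by auto
  then show ?case
    using mm_decomp_subset[OF mm_dims_mult[OF d Suc.IH]] by simp
qed

text \<open>The coefficients take only values in the finite set \<open>B\<close>, so they are combinations of elements of
  \<open>B\<close> with coefficients 0 and 1; the additive map \<open>\<phi>\<close> then only has to evaluate triple products.\<close>

lemma mm_decomp_descend:
  fixes B :: "'k::field set" and \<phi> :: "'k \<Rightarrow> 'f::field"
  assumes d: "mm_decomp B I J K R" and fin: "finite B"
    and \<phi>: "\<And>x y. \<phi> (x + y) = \<phi> x + \<phi> y" "\<phi> 1 = 1"
  shows "mm_decomp (UNIV :: 'f set) I J K (R * card B ^ 3)"
proof -
  from d obtain f g h where D: "mm_decomp_by B I J K {..<R} f g h"
    unfolding mm_decomp_def by blast
  note mem = mm_decomp_by_mem[OF D] and eq = mm_decomp_by_eq[OF D]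
  have \<phi>0: "\<phi> 0 = 0"
    using add_cancel_left_left[of "\<phi> 0" "\<phi> 0"] \<phi>(1)[of 0 0] by (metis add_0)
  have sum: "\<phi> (sum t A) = (\<Sum>x\<in>A. \<phi> (t x))" for t and A :: "nat set"
    by (induction A rule: infinite_finite_induct) (simp_all add: \<phi> \<phi>0)
  have ind: "(\<Sum>x\<in>B. of_bool (b = x) * G x) = G b" if "b \<in> B" for b and G :: "'k \<Rightarrow> 'f"
  proof -
    have "(\<Sum>x\<in>B. of_bool (b = x) * G x) = (\<Sum>x\<in>B. if b = x then G x else 0)"
      by (rule sum.cong) auto
    then show ?thesis
      using that fin by (simp add: sum.delta')
  qed
  \<comment> \<open>Each summand is split according to the values \<open>x\<close>,
    \<open>y\<close>, \<open>z\<close> of its three coefficients; this is the source of the factor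
    \<open>card B ^ 3\<close>.\<close>
  let ?\<Lambda> = "{..<R} \<times> B \<times> B \<times> B"
  show ?thesis
  proof (rule mm_decompI[where \<Lambda> = ?\<Lambda>
        and f = "\<lambda>(l, x, y, z) i j. of_bool (f l i j = x)"
        and g = "\<lambda>(l, x, y, z) j k. of_bool (g l j k = y)"
        and h = "\<lambda>(l, x, y, z) i k. of_bool (h l i k = z) * \<phi> (x * y * z)"])
    fix i j j' k i' k'
    assume *: "i \<in> I" "j \<in> J" "j' \<in> J" "k \<in> K" "i' \<in> I" "k' \<in> K"
    have "of_bool (i = i' \<and> j = j' \<and> k = k') = \<phi> (of_bool (i = i' \<and> j = j' \<and> k = k'))"
      by (simp add: \<phi> \<phi>0 of_bool_def)
    also have "\<dots> = (\<Sum>l<R. \<phi> (f l i j * g l j' k * h l i' k'))"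
      by (simp only: eq[OF *, symmetric] sum)
    also have "\<dots> = (\<Sum>l<R. \<Sum>x\<in>B. of_bool (f l i j = x) * (\<Sum>y\<in>B. of_bool (g l j' k = y) *
        (\<Sum>z\<in>B. of_bool (h l i' k' = z) * \<phi> (x * y * z))))"
    proof (rule sum.cong[OF refl])
      fix l assume "l \<in> {..<R}"
      then have "f l i j \<in> B" "g l j' k \<in> B" "h l i' k' \<in> B"
        using mem * by auto
      then show "\<phi> (f l i j * g l j' k * h l i' k') =
        (\<Sum>x\<in>B. of_bool (f l i j = x) * (\<Sum>y\<in>B. of_bool (g l j' k = y) *
        (\<Sum>z\<in>B. of_bool (h l i' k' = z) * \<phi> (x * y * z))))"
        by (simp only: ind)
    qed
    also have "\<dots> = (\<Sum>m\<in>?\<Lambda>. (case m of (l, x, y, z) \<Rightarrow> of_bool (f l i j = x) * of_bool (g l j' k = y)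
        * (of_bool (h l i' k' = z) * \<phi> (x * y * z))))"
      unfolding sum_distrib_left sum.cartesian_product
      by (rule sum.cong) (auto simp: mult.assoc)
    finally show "(\<Sum>m\<in>?\<Lambda>. (case m of (l, x, y, z) \<Rightarrow> \<lambda>i j. of_bool (f l i j = x)) i j
         * (case m of (l, x, y, z) \<Rightarrow> \<lambda>j k. of_bool (g l j k = y)) j' k
         * (case m of (l, x, y, z) \<Rightarrow> \<lambda>i k. of_bool (h l i k = z) * \<phi> (x * y * z)) i' k')
         = of_bool (i = i' \<and> j = j' \<and> k = k')"
      by (simp only: case_prod_beta)
  qed (use fin in \<open>auto simp: power3_eq_cube\<close>)
qed

lemma rf_const_simps:
  "rf_const 0 = (0 :: 'f::field ratfun)" "rf_const 1 = (1 :: 'f ratfun)"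
  "rf_const (a + b) = rf_const a + (rf_const b :: 'f ratfun)"
  "rf_const (a * b) = rf_const a * (rf_const b :: 'f ratfun)"
  by (simp_all add: rf_const_def Zero_fract_def One_fract_def single_add mult_single)

text \<open>\<open>1\<close> extends to a basis of the rational functions over the scalars, and a
  linear functional may take any values on a basis. Multiplicativity is out of reach for finite
  \<open>'f\<close>, because homomorphisms of fields are injective.\<close>

lemma additive_retraction_exists:
  "\<exists>\<phi> :: 'f::field ratfun \<Rightarrow> 'f. (\<forall>x y. \<phi> (x + y) = \<phi> x + \<phi> y) \<and> \<phi> 1 = 1"
proof -
  interpret vector_space_pair "\<lambda>(c::'f) (x::'f ratfun). rf_const c * x" "(*) :: 'f \<Rightarrow> 'f \<Rightarrow> 'f"
    by unfold_locales (simp_all add: rf_const_simps algebra_simps)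
  have "vs1.independent {1}"
    by (simp add: vs1.dependent_single)
  from linear_independent_extend[OF this, of "\<lambda>_. 1"]
  obtain \<phi> where \<phi>: "Vector_Spaces.linear (\<lambda>(c::'f) (x::'f ratfun). rf_const c * x) (*) \<phi>" "\<phi> 1 = 1"
    by auto
  then show ?thesis
    by (auto simp: linear_add intro!: exI[of _ \<phi>])
qed

text \<open>The degree \<open>e\<close> is fixed by the decomposition before \<open>t\<close> is
  chosen, since only finitely many coefficients occur. Descending a \<open>t\<close>-th power thus
  costs a factor polynomial in \<open>t\<close>.\<close>

lemma mm_dims_ratfun_power_descend:
  assumes d: "mm_dims (UNIV :: 'f::field ratfun set) p q r R"
  shows "\<exists>e. \<forall>t. \<exists>R'\<le>R ^ t * (t + 1) ^ e. mm_dims (UNIV :: 'f set) (p ^ t) (q ^ t) (r ^ t) R'"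
proof -
  from d obtain f g h :: "nat \<Rightarrow> nat \<Rightarrow> nat \<Rightarrow> 'f ratfun"
    where D: "mm_decomp_by UNIV {..<p} {..<q} {..<r} {..<R} f g h"
    unfolding mm_decomp_def by blast
  define E where "E = (\<Union>l<R. (\<Union>i<p. f l i ` {..<q}) \<union> (\<Union>j<q. g l j ` {..<r}) \<union> (\<Union>i<p. h l i ` {..<r}))"
  have fin: "finite E"
    unfolding E_def by auto
  have "mm_decomp_by E {..<p} {..<q} {..<r} {..<R} f g h"
    unfolding mm_decomp_by_def
  proof (intro conjI ballI)
    fix l assume l: "l \<in> {..<R}"
    show "f l i j \<in> E" if "i \<in> {..<p}" "j \<in> {..<q}" for i j
      unfolding E_def by (rule UN_I[OF l], rule UnI1, rule UnI1, rule UN_I[OF that(1) imageI[OF that(2)]])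
    show "g l i j \<in> E" if "i \<in> {..<q}" "j \<in> {..<r}" for i j
      unfolding E_def by (rule UN_I[OF l], rule UnI1, rule UnI2, rule UN_I[OF that(1) imageI[OF that(2)]])
    show "h l i j \<in> E" if "i \<in> {..<p}" "j \<in> {..<r}" for i j
      unfolding E_def by (rule UN_I[OF l], rule UnI2, rule UN_I[OF that(1) imageI[OF that(2)]])
  qed (rule mm_decomp_by_eq[OF D])
  then have d': "mm_dims E p q r R"
    unfolding mm_decomp_def by blast
  obtain \<phi> :: "'f ratfun \<Rightarrow> 'f" where \<phi>: "\<And>x y. \<phi> (x + y) = \<phi> x + \<phi> y" "\<phi> 1 = 1"
    using additive_retraction_exists by blast
  have "\<exists>R'\<le>R ^ t * (t + 1) ^ (card E * 3). mm_dims (UNIV :: 'f set) (p ^ t) (q ^ t) (r ^ t) R'" for t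
  proof (intro exI conjI)
    show "mm_dims (UNIV :: 'f set) (p ^ t) (q ^ t) (r ^ t) (R ^ t * card (monomial_values E t) ^ 3)"
      by (rule mm_decomp_descend[OF mm_dims_power[OF fin d'] finite_monomial_values[OF fin] \<phi>])
    show "R ^ t * card (monomial_values E t) ^ 3 \<le> R ^ t * (t + 1) ^ (card E * 3)"
      unfolding power_mult by (intro mult_left_mono power_mono card_monomial_values_le fin) auto
  qed
  then show ?thesis by blast
qed

section \<open>From rank decompositions to straight-line programs\<close>

lemma straight_line_mono: "straight_line S gs \<Longrightarrow> S \<subseteq> S' \<Longrightarrow> straight_line S' gs"
proof (induction rule: straight_line.induct)
  case (step gs u v g)
  show ?case
    by (rule straight_line.step[OF _ _ _ step.hyps(4)]) (use step in auto)
qed (rule straight_line.empty)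

lemma straight_line_append:
  assumes "straight_line (S \<union> set gs) hs" "straight_line S gs"
  shows "straight_line S (gs @ hs)"
  using assms
proof (induction rule: straight_line.induct)
  case (step hs u v g)
  then have "straight_line S ((gs @ hs) @ [g])"
    by (intro straight_line.step[of S "gs @ hs" u v g]) (simp_all add: Un_assoc)
  then show ?case by simp
qed simp

lemma computable_in_mono:
  "computable_in S Y s \<Longrightarrow> S \<subseteq> S' \<Longrightarrow> Y' \<subseteq> Y \<Longrightarrow> s \<le> s' \<Longrightarrow> computable_in S' Y' s'"
  unfolding computable_in_def
  by (elim exE conjE, rule exI, intro conjI, erule (1) straight_line_mono) auto

lemma computable_in_trans:
  assumes "computable_in S Y s" "computable_in (S \<union> Y) Z s'"
  shows "computable_in S (Y \<union> Z) (s + s')"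
proof -
  obtain gs where gs: "straight_line S gs" "length gs \<le> s" "Y \<subseteq> S \<union> set gs"
    using assms(1) unfolding computable_in_def by blast
  obtain hs where hs: "straight_line (S \<union> Y) hs" "length hs \<le> s'" "Z \<subseteq> S \<union> Y \<union> set hs"
    using assms(2) unfolding computable_in_def by blast
  have "straight_line S (gs @ hs)"
    by (rule straight_line_append[OF straight_line_mono[OF hs(1)] gs(1)]) (use gs in auto)
  then show ?thesis
    unfolding computable_in_def by (intro exI[of _ "gs @ hs"]) (use gs hs in auto)
qed

lemma computable_in_Un:
  assumes "computable_in S Y s" "computable_in S Z s'"
  shows "computable_in S (Y \<union> Z) (s + s')"
  by (rule computable_in_trans[OF assms(1) computable_in_mono[OF assms(2)]]) auto

lemma computable_in_inputs: "Y \<subseteq> S \<Longrightarrow> computable_in S Y 0"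
  unfolding computable_in_def by (intro exI[of _ "[]"]) (auto intro: straight_line.empty)

lemma computable_in_UN:
  assumes "finite A" "\<And>a. a \<in> A \<Longrightarrow> computable_in S (Y a) s"
  shows "computable_in S (\<Union>a\<in>A. Y a) (card A * s)"
  using assms
proof (induction A rule: finite_induct)
  case empty
  then show ?case by (simp add: computable_in_inputs)
next
  case (insert a A)
  then show ?case using computable_in_Un[of S "Y a" s "\<Union>a\<in>A. Y a" "card A * s"] by simp
qed

lemma computable_in_image:
  assumes "finite A" "\<And>a. a \<in> A \<Longrightarrow> computable_in S {y a} s"
  shows "computable_in S (y ` A) (card A * s)"
  using computable_in_UN[of A S "\<lambda>a. {y a}" s] assms by (simp add: UNION_singleton_eq_range)

lemma computable_in_step:
  assumes "u \<in> S" "v \<in> S"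
  shows "computable_in S {u + v} 1" "computable_in S {u * v} 1"
proof -
  have "straight_line S ([] @ [g])" if "g = u + v \<or> g = u * v" for g
    by (rule straight_line.step[OF straight_line.empty, of u _ v]) (use assms that in auto)
  from this[of "u + v"] this[of "u * v"] show "computable_in S {u + v} 1" "computable_in S {u * v} 1"
    unfolding computable_in_def by force+
qed

text \<open>The accumulation starts at the free scalar 0, so every term costs one multiplication and
  one addition.\<close>

lemma computable_in_sum_products:
  assumes "finite A" "0 \<in> S" "\<And>a. a \<in> A \<Longrightarrow> c a \<in> S" "\<And>a. a \<in> A \<Longrightarrow> x a \<in> S"
  shows "computable_in S {\<Sum>a\<in>A. c a * x a} (2 * card A)"
  using assms
proof (induction A rule: finite_induct)
  case empty
  then show ?case by (simp add: computable_in_inputs)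
next
  case (insert a A)
  let ?y = "\<Sum>a\<in>A. c a * x a"
  have 1: "computable_in S ({?y} \<union> {c a * x a}) (2 * card A + 1)"
    by (rule computable_in_Un[OF insert.IH computable_in_step(2)]) (use insert.prems in auto)
  have 2: "computable_in (S \<union> ({?y} \<union> {c a * x a})) {c a * x a + ?y} 1"
    by (rule computable_in_step(1)) auto
  show ?case
    by (rule computable_in_mono[OF computable_in_trans[OF 1 2]]) (use insert in auto)
qed

section \<open>Cost of matrix multiplication by blocks\<close>

definition product_entries :: "nat \<Rightarrow> nat \<Rightarrow> nat \<Rightarrow> (nat \<Rightarrow> nat \<Rightarrow> 'k::field) \<Rightarrow> (nat \<Rightarrow> nat \<Rightarrow> 'k) \<Rightarrow> 'k set" where
  "product_entries p q r A B = (\<lambda>(i, k). \<Sum>j<q. A i j * B j k) ` ({..<p} \<times> {..<r})"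

text \<open>The entries are arbitrary available values rather than indeterminates, so that the
  notion applies to the blocks that arise within a longer computation. \<open>C\<close> holds the
  free scalars.\<close>

definition mult_cost :: "'k::field set \<Rightarrow> nat \<Rightarrow> nat \<Rightarrow> nat \<Rightarrow> nat \<Rightarrow> bool" where
  "mult_cost C p q r s \<longleftrightarrow> (\<forall>S A B. C \<subseteq> S \<longrightarrow> (\<forall>i<p. \<forall>j<q. A i j \<in> S) \<longrightarrow> (\<forall>j<q. \<forall>k<r. B j k \<in> S) \<longrightarrow>
     computable_in S (product_entries p q r A B) s)"

lemma mult_costD:
  assumes "mult_cost C p q r s" "C \<subseteq> S"
    and "\<And>i j. i < p \<Longrightarrow> j < q \<Longrightarrow> A i j \<in> S" "\<And>j k. j < q \<Longrightarrow> k < r \<Longrightarrow> B j k \<in> S"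
  shows "computable_in S (product_entries p q r A B) s"
  using assms(1)[unfolded mult_cost_def, THEN spec[of _ S], THEN spec[of _ A], THEN spec[of _ B]] assms(2-4)
  by simp

lemma mult_cost_naive:
  assumes "0 \<in> C"
  shows "mult_cost C p q r (p * r * (2 * q))"
  unfolding mult_cost_def
proof (intro allI impI)
  fix S A B
  assume *: "C \<subseteq> S" "\<forall>i<p. \<forall>j<q. A i j \<in> S" "\<forall>j<q. \<forall>k<r. B j k \<in> S"
  have "computable_in S (product_entries p q r A B) (card ({..<p} \<times> {..<r}) * (2 * card {..<q}))"
    unfolding product_entries_def
  proof (rule computable_in_image)
    fix a assume "a \<in> {..<p} \<times> {..<r}"
    then show "computable_in S {case a of (i, k) \<Rightarrow> \<Sum>j<q. A i j * B j k} (2 * card {..<q})"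
      using * assms by (auto simp del: card_lessThan intro!: computable_in_sum_products)
  qed simp
  then show "computable_in S (product_entries p q r A B) (p * r * (2 * q))" by simp
qed

lemma mult_cost_weaken: "mult_cost C p q r s \<Longrightarrow> s \<le> s' \<Longrightarrow> mult_cost C p q r s'"
  unfolding mult_cost_def by (blast intro: computable_in_mono[OF _ subset_refl subset_refl])

text \<open>The smaller matrices are bordered with zeros, which are free; the wanted product is a
  corner of the padded one.\<close>

lemma mult_cost_pad:
  assumes C: "0 \<in> C" and m: "mult_cost C p q r s" and le: "p' \<le> p" "q' \<le> q" "r' \<le> r"
  shows "mult_cost C p' q' r' s"
  unfolding mult_cost_def
proof (intro allI impI)
  fix S A B
  assume *: "C \<subseteq> S" "\<forall>i<p'. \<forall>j<q'. A i j \<in> S" "\<forall>j<q'. \<forall>k<r'. B j k \<in> S"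
  define A' where "A' i j = (if i < p' \<and> j < q' then A i j else 0)" for i j
  define B' where "B' j k = (if j < q' \<and> k < r' then B j k else 0)" for j k
  have "computable_in S (product_entries p q r A' B') s"
    by (rule mult_costD[OF m]) (use C * in \<open>auto simp: A'_def B'_def\<close>)
  moreover have "product_entries p' q' r' A B \<subseteq> product_entries p q r A' B'"
  proof -
    have "(\<Sum>j<q. A' i j * B' j k) = (\<Sum>j<q'. A i j * B j k)" if "i < p'" "k < r'" for i k
      by (rule sum.mono_neutral_cong_right) (use le that in \<open>auto simp: A'_def B'_def\<close>)
    then have "product_entries p' q' r' A B = (\<lambda>(i, k). \<Sum>j<q. A' i j * B' j k) ` ({..<p'} \<times> {..<r'})"
      unfolding product_entries_def by (intro image_cong) auto
    then show ?thesis
      unfolding product_entries_def using le by (auto intro!: image_mono)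
  qed
  ultimately show "computable_in S (product_entries p' q' r' A B) s"
    by (rule computable_in_mono[OF _ subset_refl _ order_refl])
qed

lemma sum_of_bool_mult:
  fixes G :: "'i \<Rightarrow> 'a::semiring_1"
  assumes "finite A" "a \<in> A"
  shows "(\<Sum>x\<in>A. of_bool (x = a) * G x) = G a"
proof -
  have "(\<Sum>x\<in>A. of_bool (x = a) * G x) = (\<Sum>x\<in>A. if x = a then G x else 0)"
    by (rule sum.cong) auto
  then show ?thesis using assms by (simp add: sum.delta)
qed

lemma sum_blocks: "(\<Sum>j<Q * q. F j) = (\<Sum>b<Q. \<Sum>j<q. F (b * q + j :: nat))"
proof -
  have "(\<Sum>j\<in>{b * q..<b * q + q}. F j) = (\<Sum>j<q. F (b * q + j))" for b
    using sum.shift_bounds_nat_ivl[of F 0 "b * q" q] by (simp add: lessThan_atLeast0 add.commute)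
  then show ?thesis
    unfolding sum.nat_group[symmetric] by simp
qed

text \<open>A decomposition read as a bilinear algorithm: form \<open>\<rho>\<close> pairs of linear
  combinations of the entries, multiply each pair, and combine the products with the weights
  \<open>h\<close>. Summing over \<open>l\<close> first leaves only the terms with equal inner
  index.\<close>

lemma mm_decomp_by_apply:
  fixes f g h :: "nat \<Rightarrow> nat \<Rightarrow> nat \<Rightarrow> 'a::field"
  assumes D: "mm_decomp_by C {..<P} {..<Q} {..<R} {..<\<rho>} f g h" and i: "i < P" and k: "k < R"
  shows "(\<Sum>l<\<rho>. (\<Sum>(a, b)\<in>{..<P} \<times> {..<Q}. f l a b * X a b)
             * (\<Sum>(b, c)\<in>{..<Q} \<times> {..<R}. g l b c * Y b c) * h l i k)
       = (\<Sum>b<Q. X i b * Y b k)"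
proof -
  let ?A = "{..<P} \<times> {..<Q}" and ?B = "{..<Q} \<times> {..<R}"
  have "(\<Sum>l<\<rho>. (\<Sum>(a, b)\<in>?A. f l a b * X a b) * (\<Sum>(b, c)\<in>?B. g l b c * Y b c) * h l i k)
    = (\<Sum>l<\<rho>. \<Sum>x\<in>?A. \<Sum>y\<in>?B. X (fst x) (snd x) * Y (fst y) (snd y)
        * (f l (fst x) (snd x) * g l (fst y) (snd y) * h l i k))"
    unfolding sum_product by (simp add: case_prod_beta sum_distrib_left mult_ac)
  also have "\<dots> = (\<Sum>x\<in>?A. \<Sum>y\<in>?B. \<Sum>l<\<rho>. X (fst x) (snd x) * Y (fst y) (snd y)
        * (f l (fst x) (snd x) * g l (fst y) (snd y) * h l i k))"
    by (subst sum.swap, rule sum.cong[OF refl], rule sum.swap)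
  also have "\<dots> = (\<Sum>x\<in>?A. \<Sum>y\<in>?B. X (fst x) (snd x) * Y (fst y) (snd y)
        * of_bool (fst x = i \<and> snd x = fst y \<and> snd y = k))"
  proof (intro sum.cong refl)
    fix x y assume "x \<in> ?A" "y \<in> ?B"
    then have "(\<Sum>l<\<rho>. f l (fst x) (snd x) * g l (fst y) (snd y) * h l i k)
        = of_bool (fst x = i \<and> snd x = fst y \<and> snd y = k)"
      using mm_decomp_by_eq[OF D, of "fst x" "snd x" "fst y" "snd y" i k] i k by auto
    then show "(\<Sum>l<\<rho>. X (fst x) (snd x) * Y (fst y) (snd y) * (f l (fst x) (snd x) * g l (fst y) (snd y) * h l i k))
       = X (fst x) (snd x) * Y (fst y) (snd y) * of_bool (fst x = i \<and> snd x = fst y \<and> snd y = k)"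
      by (simp flip: sum_distrib_left)
  qed
  also have "\<dots> = (\<Sum>x\<in>?A. of_bool (fst x = i) * (X (fst x) (snd x) * Y (snd x) k))"
  proof (rule sum.cong[OF refl])
    fix x assume x: "x \<in> ?A"
    have "(\<Sum>y\<in>?B. X (fst x) (snd x) * Y (fst y) (snd y) * of_bool (fst x = i \<and> snd x = fst y \<and> snd y = k))
      = (\<Sum>y\<in>?B. of_bool (y = (snd x, k)) * (of_bool (fst x = i) * (X (fst x) (snd x) * Y (fst y) (snd y))))"
      by (rule sum.cong) (auto simp: prod_eq_iff)
    then show "(\<Sum>y\<in>?B. X (fst x) (snd x) * Y (fst y) (snd y) * of_bool (fst x = i \<and> snd x = fst y \<and> snd y = k))
      = of_bool (fst x = i) * (X (fst x) (snd x) * Y (snd x) k)"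
      using x k by (subst (asm) sum_of_bool_mult) auto
  qed
  also have "\<dots> = (\<Sum>a<P. of_bool (a = i) * (\<Sum>b<Q. X a b * Y b k))"
    unfolding sum_distrib_left sum.cartesian_product by (simp add: case_prod_beta)
  also have "\<dots> = (\<Sum>b<Q. X i b * Y b k)"
    using i by (subst sum_of_bool_mult) auto
  finally show ?thesis .
qed

text \<open>One level of block recursion: \<open>\<rho>\<close> products of blocks are formed
  recursively, and the second summand pays for the linear combinations before and after them, two
  operations per term.\<close>

lemma mult_cost_step:
  fixes C :: "'k::field set"
  assumes d: "mm_dims C P Q R \<rho>" and zero: "0 \<in> C" and m: "mult_cost C p q r s"
  shows "mult_cost C (P * p) (Q * q) (R * r)
    (\<rho> * s + 2 * \<rho> * (P * p * (Q * q) + Q * q * (R * r) + P * p * (R * r)))"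
  unfolding mult_cost_def
proof (intro allI impI)
  fix S A B
  assume C: "C \<subseteq> S" and A: "\<forall>i<P * p. \<forall>j<Q * q. A i j \<in> S" and B: "\<forall>j<Q * q. \<forall>k<R * r. B j k \<in> S"
  from d obtain f g h where D: "mm_decomp_by C {..<P} {..<Q} {..<R} {..<\<rho>} f g h"
    unfolding mm_decomp_def by blast
  have blk: "x * y + z < n * y" if "x < n" "z < y" for x y z n :: nat
  proof -
    have "x * y + z < (x + 1) * y" using that by simp
    also have "\<dots> \<le> n * y" using that by (intro mult_right_mono) auto
    finally show ?thesis .
  qed
  \<comment> \<open>Entry \<open>(i, j)\<close> of block \<open>(a, b)\<close> of \<open>A\<close>
    sits at \<open>(a * p + i, b * q + j)\<close>. \<open>F l\<close> and \<open>G l\<close> are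
    combined blocks, \<open>M l\<close> is their product.\<close>
  define F where "F l i j = (\<Sum>(a, b)\<in>{..<P} \<times> {..<Q}. f l a b * A (a * p + i) (b * q + j))" for l i j
  define G where "G l j k = (\<Sum>(b, c)\<in>{..<Q} \<times> {..<R}. g l b c * B (b * q + j) (c * r + k))" for l j k
  define M where "M l i k = (\<Sum>j<q. F l i j * G l j k)" for l i k
  define YF where "YF = (\<lambda>(l, i, j). F l i j) ` ({..<\<rho>} \<times> {..<p} \<times> {..<q})"
  define YG where "YG = (\<lambda>(l, j, k). G l j k) ` ({..<\<rho>} \<times> {..<q} \<times> {..<r})"
  define YM where "YM = (\<Union>l\<in>{..<\<rho>}. product_entries p q r (F l) (G l))"
  define Z where "Z = product_entries (P * p) (Q * q) (R * r) A B"
  have F1: "computable_in S {F l i j} (2 * (P * Q))" if "l < \<rho>" "i < p" "j < q" for l i j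
  proof -
    have "computable_in S {\<Sum>x\<in>{..<P} \<times> {..<Q}. f l (fst x) (snd x) * A (fst x * p + i) (snd x * q + j)}
       (2 * card ({..<P} \<times> {..<Q}))"
      by (rule computable_in_sum_products)
         (use C zero A that blk mm_decomp_by_mem(1)[OF D, of l] in auto)
    then show ?thesis by (simp add: F_def case_prod_beta)
  qed
  have G1: "computable_in S {G l j k} (2 * (Q * R))" if "l < \<rho>" "j < q" "k < r" for l j k
  proof -
    have "computable_in S {\<Sum>x\<in>{..<Q} \<times> {..<R}. g l (fst x) (snd x) * B (fst x * q + j) (snd x * r + k)}
       (2 * card ({..<Q} \<times> {..<R}))"
      by (rule computable_in_sum_products)
         (use C zero B that blk mm_decomp_by_mem(2)[OF D, of l] in auto)
    then show ?thesis by (simp add: G_def case_prod_beta)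
  qed
  have "computable_in S YF (card ({..<\<rho>} \<times> {..<p} \<times> {..<q}) * (2 * (P * Q)))"
    unfolding YF_def by (rule computable_in_image) (auto intro: F1)
  moreover have "computable_in S YG (card ({..<\<rho>} \<times> {..<q} \<times> {..<r}) * (2 * (Q * R)))"
    unfolding YG_def by (rule computable_in_image) (auto intro: G1)
  ultimately have 1: "computable_in S (YF \<union> YG) (\<rho> * (p * q) * (2 * (P * Q)) + \<rho> * (q * r) * (2 * (Q * R)))"
    by (intro computable_in_Un) auto
  have "computable_in (S \<union> (YF \<union> YG)) YM (card {..<\<rho>} * s)"
    unfolding YM_def
  proof (rule computable_in_UN)
    fix l assume l: "l \<in> {..<\<rho>}"
    show "computable_in (S \<union> (YF \<union> YG)) (product_entries p q r (F l) (G l)) s"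
    proof (rule mult_costD[OF m])
      show "F l i j \<in> S \<union> (YF \<union> YG)" if "i < p" "j < q" for i j
        using l that unfolding YF_def by (intro UnI2 UnI1 image_eqI[of _ _ "(l, i, j)"]) auto
      show "G l j k \<in> S \<union> (YF \<union> YG)" if "j < q" "k < r" for j k
        using l that unfolding YG_def by (intro UnI2 image_eqI[of _ _ "(l, j, k)"]) auto
    qed (use C in auto)
  qed simp
  from computable_in_trans[OF 1 this]
  have 2: "computable_in S (YF \<union> YG \<union> YM)
     (\<rho> * (p * q) * (2 * (P * Q)) + \<rho> * (q * r) * (2 * (Q * R)) + \<rho> * s)"
    by simp
  have "computable_in (S \<union> (YF \<union> YG \<union> YM)) Z (card ({..<P * p} \<times> {..<R * r}) * (2 * \<rho>))"
    unfolding Z_def product_entries_def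
  proof (rule computable_in_image)
    fix x assume "x \<in> {..<P * p} \<times> {..<R * r}"
    then obtain i k where x: "x = (i, k)" and i: "i < P * p" and k: "k < R * r"
      by auto
    from i k have pr: "p > 0" "r > 0"
      by (auto intro: gr0I)
    from i k have div: "i div p < P" "k div r < R"
      by (simp_all add: less_mult_imp_div_less)
    have MY: "M l (i mod p) (k mod r) \<in> S \<union> (YF \<union> YG \<union> YM)" if "l < \<rho>" for l
    proof -
      have "M l (i mod p) (k mod r) \<in> product_entries p q r (F l) (G l)"
        unfolding product_entries_def M_def using pr by (intro image_eqI[of _ _ "(i mod p, k mod r)"]) auto
      then show ?thesis using that unfolding YM_def by blast
    qed
    have hS: "h l (i div p) (k div r) \<in> S" if "l < \<rho>" for l
      using C mm_decomp_by_mem(3)[OF D, of l] div that by auto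
    have "computable_in (S \<union> (YF \<union> YG \<union> YM)) {\<Sum>l<\<rho>. h l (i div p) (k div r) * M l (i mod p) (k mod r)} (2 * card {..<\<rho>})"
      by (rule computable_in_sum_products)
         (use C zero hS MY in auto)
    moreover have "(\<Sum>l<\<rho>. h l (i div p) (k div r) * M l (i mod p) (k mod r)) = (\<Sum>j<Q * q. A i j * B j k)"
    proof -
      have "(\<Sum>l<\<rho>. h l (i div p) (k div r) * M l (i mod p) (k mod r))
        = (\<Sum>j<q. \<Sum>l<\<rho>. F l (i mod p) j * G l j (k mod r) * h l (i div p) (k div r))"
        unfolding M_def sum_distrib_left by (subst sum.swap) (simp add: mult_ac)
      \<comment> \<open>Once the positions \<open>i mod p\<close>, \<open>j\<close>,
        \<open>k mod r\<close> inside the blocks are fixed, the block entries are scalars, so the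
        bilinear algorithm applies to each \<open>j\<close> separately.\<close>
      also have "\<dots> = (\<Sum>j<q. \<Sum>b<Q. A (i div p * p + i mod p) (b * q + j) * B (b * q + j) (k div r * r + k mod r))"
        unfolding F_def G_def by (intro sum.cong refl mm_decomp_by_apply[OF D div])
      also have "\<dots> = (\<Sum>j<Q * q. A i j * B j k)"
        unfolding sum_blocks by (subst sum.swap) simp
      finally show ?thesis .
    qed
    ultimately show "computable_in (S \<union> (YF \<union> YG \<union> YM)) {case x of (i, k) \<Rightarrow> \<Sum>j<Q * q. A i j * B j k} (2 * \<rho>)"
      by (simp add: x)
  qed simp
  from computable_in_trans[OF 2 this]
  show "computable_in S (product_entries (P * p) (Q * q) (R * r) A B)
     (\<rho> * s + 2 * \<rho> * (P * p * (Q * q) + Q * q * (R * r) + P * p * (R * r)))"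
    unfolding Z_def[symmetric] by (rule computable_in_mono) (auto simp: algebra_simps)
qed

text \<open>The linear work of a level is governed by the sizes of the three matrices, and
  \<open>P * Q\<close>, \<open>Q * R\<close>, \<open>P * R\<close> are at most \<open>\<rho>\<close>
  by the lower bounds on the rank. Each of the \<open>t\<close> levels thus contributes at most
  \<open>6 * \<rho> * \<rho> ^ t * (a * b * c)\<close> to the total; the summand 2 comes from naive
  multiplication at the bottom.\<close>

lemma mult_cost_power:
  fixes C :: "'k::field set"
  assumes d: "mm_dims C P Q R \<rho>" and zero: "0 \<in> C"
    and pos: "P > 0" "Q > 0" "R > 0" "a > 0" "b > 0" "c > 0"
  shows "mult_cost C (P ^ t * a) (Q ^ t * b) (R ^ t * c) ((2 + 6 * \<rho> * t) * \<rho> ^ t * (a * b * c))"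
proof (induction t)
  case 0
  show ?case
    using mult_cost_naive[OF zero, of a b c] by (simp add: mult_ac)
next
  case (Suc t)
  note ge = mm_dims_rank_ge[OF d pos(1-3)]
  have bound: "X ^ Suc t * x * (Y ^ Suc t * y) \<le> \<rho> ^ Suc t * (a * b * c)"
    if "X * Y \<le> \<rho>" "x * y \<le> a * b * c" for X Y x y
  proof -
    have "X ^ Suc t * x * (Y ^ Suc t * y) = (X * Y) ^ Suc t * (x * y)"
      by (simp only: power_mult_distrib mult_ac)
    also have "\<dots> \<le> \<rho> ^ Suc t * (a * b * c)"
      by (rule mult_mono[OF power_mono[OF that(1)] that(2)]) auto
    finally show ?thesis .
  qed
  have "a * b \<le> a * b * c" "b * c \<le> a * b * c" "a * c \<le> a * b * c"
    using pos by simp_all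
  note bounds = bound[OF ge(1) this(1)] bound[OF ge(2) this(2)] bound[OF ge(3) this(3)]
  let ?N = "\<rho> ^ Suc t * (a * b * c)"
  let ?s = "(2 + 6 * \<rho> * t) * \<rho> ^ t * (a * b * c)"
  have cost: "mult_cost C (P ^ Suc t * a) (Q ^ Suc t * b) (R ^ Suc t * c)
    (\<rho> * ?s + 2 * \<rho> * (P ^ Suc t * a * (Q ^ Suc t * b) + Q ^ Suc t * b * (R ^ Suc t * c) + P ^ Suc t * a * (R ^ Suc t * c)))"
    using mult_cost_step[OF d zero Suc.IH] by (simp only: power_Suc mult.assoc)
  have "\<rho> * ?s + 2 * \<rho> * (P ^ Suc t * a * (Q ^ Suc t * b) + Q ^ Suc t * b * (R ^ Suc t * c) + P ^ Suc t * a * (R ^ Suc t * c))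
     \<le> \<rho> * ?s + 2 * \<rho> * (?N + ?N + ?N)"
    using bounds by (intro add_left_mono mult_left_mono add_mono) auto
  also have "\<dots> = (2 + 6 * \<rho> * Suc t) * \<rho> ^ Suc t * (a * b * c)"
    by (simp add: algebra_simps)
  finally show ?case
    by (rule mult_cost_weaken[OF cost])
qed

lemma matmul_in_if_mult_cost:
  assumes "mult_cost (range (rf_const :: 'f::field \<Rightarrow> 'f ratfun)) p q r s"
  shows "matmul_in TYPE('f) p q r s"
proof -
  let ?L = "generic_left p q :: 'f ratfun mat" and ?R = "generic_right q r :: 'f ratfun mat"
  let ?S = "range (rf_const :: 'f \<Rightarrow> 'f ratfun) \<union> elements_mat ?L \<union> elements_mat ?R"
  let ?x = "\<lambda>i j. rf_var (2 * prod_encode (i, j)) :: 'f ratfun"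
  let ?y = "\<lambda>j k. rf_var (2 * prod_encode (j, k) + 1) :: 'f ratfun"
  have x: "?x i j \<in> elements_mat ?L" if "i < p" "j < q" for i j
    using that by (intro elements_matI[of _ p q i j]) (auto simp: generic_left_def)
  have y: "?y i j \<in> elements_mat ?R" if "i < q" "j < r" for i j
    using that by (intro elements_matI[of _ q r i j]) (auto simp: generic_right_def)
  have "computable_in ?S (product_entries p q r ?x ?y) s"
    by (rule mult_costD[OF assms]) (use x y in auto)
  moreover have "elements_mat (?L * ?R) \<subseteq> product_entries p q r ?x ?y"
  proof
    fix e assume "e \<in> elements_mat (?L * ?R)"
    then obtain i k where "i < p" "k < r" "e = (?L * ?R) $$ (i, k)"
      by (auto simp: generic_left_def generic_right_def dest!: elements_matD)
    then show "e \<in> product_entries p q r ?x ?y"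
      unfolding product_entries_def by (intro image_eqI[of _ _ "(i, k)"]) (auto simp: generic_product_index)
  qed
  ultimately show ?thesis
    unfolding matmul_in_def by (rule computable_in_mono[OF _ subset_refl _ order_refl])
qed

section \<open>Consequences of a separating family of two-sided multiplications\<close>

text \<open>Gaussian elimination with one pivot per column: a trivial kernel yields a pivot in
  column \<open>b0\<close>, and the kernel stays trivial after that column is cleared and
  removed.\<close>

lemma left_inverse_exists:
  fixes W :: "'a \<Rightarrow> 'b \<Rightarrow> 'f::field"
  assumes "finite B" and finA: "finite A"
    and "\<And>m. (\<And>a. a \<in> A \<Longrightarrow> (\<Sum>b\<in>B. W a b * m b) = 0) \<Longrightarrow> (\<And>b. b \<in> B \<Longrightarrow> m b = 0)"
  shows "\<exists>c. \<forall>b\<in>B. \<forall>b'\<in>B. (\<Sum>a\<in>A. c b a * W a b') = of_bool (b = b')"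
  using assms(1,3)
proof (induction B arbitrary: W rule: finite_induct)
  case empty
  then show ?case by simp
next
  case (insert b0 B)
  have "\<exists>a0\<in>A. W a0 b0 \<noteq> 0"
  proof (rule ccontr)
    assume "\<not> ?thesis"
    then have "(\<Sum>b\<in>insert b0 B. W a b * of_bool (b = b0)) = 0" if "a \<in> A" for a
      using that insert.hyps by (auto intro!: sum.neutral)
    from insert.prems[OF this, of b0] show False by simp
  qed
  then obtain a0 where a0: "a0 \<in> A" "W a0 b0 \<noteq> 0" by blast
  \<comment> \<open>Subtracting multiples of the pivot row \<open>a0\<close> clears column
    \<open>b0\<close>.\<close>
  define W' where "W' a b = W a b - W a b0 / W a0 b0 * W a0 b" for a b
  have "\<exists>c. \<forall>b\<in>B. \<forall>b'\<in>B. (\<Sum>a\<in>A. c b a * W' a b') = of_bool (b = b')"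
  proof (rule insert.IH)
    fix m b assume m: "\<And>a. a \<in> A \<Longrightarrow> (\<Sum>b\<in>B. W' a b * m b) = 0" and b: "b \<in> B"
    \<comment> \<open>The coordinate at \<open>b0\<close> is chosen so that row \<open>a0\<close>
      annihilates \<open>m'\<close>; the rows of \<open>W\<close> then act on \<open>m'\<close> as
      those of \<open>W'\<close> act on \<open>m\<close>.\<close>
    define m' where "m' = m(b0 := - (\<Sum>b\<in>B. W a0 b * m b) / W a0 b0)"
    have "(\<Sum>b\<in>insert b0 B. W a b * m' b) = 0" if "a \<in> A" for a
    proof -
      have "(\<Sum>b\<in>B. W a b * m' b) = (\<Sum>b\<in>B. W a b * m b)"
        using insert.hyps by (intro sum.cong) (auto simp: m'_def)
      then have "(\<Sum>b\<in>insert b0 B. W a b * m' b)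
          = (\<Sum>b\<in>B. W a b * m b) - W a b0 / W a0 b0 * (\<Sum>b\<in>B. W a0 b * m b)"
        using insert.hyps by (simp add: m'_def)
      also have "\<dots> = (\<Sum>b\<in>B. W' a b * m b)"
        by (simp add: W'_def sum_distrib_left sum_subtractf[symmetric] algebra_simps)
      finally show ?thesis using m[OF that] by simp
    qed
    from insert.prems[OF this, of b] show "m b = 0"
      using b insert.hyps by (auto simp: m'_def split: if_splits)
  qed
  then obtain c' where c': "\<And>b b'. b \<in> B \<Longrightarrow> b' \<in> B \<Longrightarrow> (\<Sum>a\<in>A. c' b a * W' a b') = of_bool (b = b')"
    by blast
  \<comment> \<open>Transfers the row operations to the weights: \<open>c2\<close> applied to
    \<open>W\<close> equals \<open>c'\<close> applied to \<open>W'\<close>, hence gives 0 on column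
    \<open>b0\<close>.\<close>
  define c2 where "c2 b a = c' b a - of_bool (a = a0) * ((\<Sum>a'\<in>A. c' b a' * W a' b0) / W a0 b0)" for b a
  have pick: "(\<Sum>a\<in>A. of_bool (a = a0) * G a) = G a0" for G :: "'a \<Rightarrow> 'f"
    by (rule sum_of_bool_mult[OF finA a0(1)])
  have c2W: "(\<Sum>a\<in>A. c2 b a * W a b') = (\<Sum>a\<in>A. c' b a * W' a b')" for b b'
  proof -
    have "(\<Sum>a\<in>A. c2 b a * W a b')
      = (\<Sum>a\<in>A. c' b a * W a b') - (\<Sum>a\<in>A. of_bool (a = a0) * ((\<Sum>a'\<in>A. c' b a' * W a' b0) / W a0 b0 * W a b'))"
      by (simp add: c2_def sum_subtractf[symmetric] algebra_simps)
    also have "\<dots> = (\<Sum>a\<in>A. c' b a * W a b') - (\<Sum>a'\<in>A. c' b a' * W a' b0) / W a0 b0 * W a0 b'"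
      by (subst pick) simp
    also have "\<dots> = (\<Sum>a\<in>A. c' b a * W' a b')"
      by (simp add: W'_def sum_distrib_left sum_distrib_right sum_divide_distrib sum_subtractf[symmetric] algebra_simps)
    finally show ?thesis .
  qed
  have c2B: "(\<Sum>a\<in>A. c2 b a * W a b') = of_bool (b = b')" if "b \<in> B" "b' \<in> B" for b b'
    using c2W c' that by simp
  have c2b0: "(\<Sum>a\<in>A. c2 b a * W a b0) = 0" for b
    unfolding c2W using a0 by (simp add: W'_def)
  \<comment> \<open>The missing row for \<open>b0\<close> is the normalised pivot row with its
    entries in the columns of \<open>B\<close> removed by means of \<open>c2\<close>.\<close>
  define c3 where "c3 a = of_bool (a = a0) * (1 / W a0 b0) - (\<Sum>b\<in>B. W a0 b / W a0 b0 * c2 b a)" for a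
  have c3W: "(\<Sum>a\<in>A. c3 a * W a b') = W a0 b' / W a0 b0 - (\<Sum>b\<in>B. W a0 b / W a0 b0 * (\<Sum>a\<in>A. c2 b a * W a b'))" for b'
  proof -
    have "(\<Sum>a\<in>A. c3 a * W a b') = (\<Sum>a\<in>A. of_bool (a = a0) * (1 / W a0 b0 * W a b'))
       - (\<Sum>a\<in>A. \<Sum>b\<in>B. W a0 b / W a0 b0 * (c2 b a * W a b'))"
      by (simp add: c3_def left_diff_distrib sum_subtractf sum_distrib_right mult.assoc)
    also have "(\<Sum>a\<in>A. of_bool (a = a0) * (1 / W a0 b0 * W a b')) = W a0 b' / W a0 b0"
      by (subst pick) simp
    also have "(\<Sum>a\<in>A. \<Sum>b\<in>B. W a0 b / W a0 b0 * (c2 b a * W a b'))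
       = (\<Sum>b\<in>B. W a0 b / W a0 b0 * (\<Sum>a\<in>A. c2 b a * W a b'))"
      by (subst sum.swap) (simp add: sum_distrib_left)
    finally show ?thesis .
  qed
  have c3b0: "(\<Sum>a\<in>A. c3 a * W a b0) = 1"
    unfolding c3W c2b0 using a0 by simp
  have c3B: "(\<Sum>a\<in>A. c3 a * W a b') = 0" if "b' \<in> B" for b'
  proof -
    have "(\<Sum>b\<in>B. W a0 b / W a0 b0 * (\<Sum>a\<in>A. c2 b a * W a b')) = (\<Sum>b\<in>B. of_bool (b = b') * (W a0 b / W a0 b0))"
      using that by (intro sum.cong) (auto simp: c2B)
    then show ?thesis
      unfolding c3W using sum_of_bool_mult[OF insert.hyps(1) that, of "\<lambda>b. W a0 b / W a0 b0"] by simp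
  qed
  show ?case
    by (rule exI[of _ "\<lambda>b. if b = b0 then c3 else c2 b"])
       (use insert.hyps in \<open>auto simp: c3b0 c3B c2B c2b0\<close>)
qed

text \<open>The left factor consists of \<open>n\<close> blocks of format \<open>(P, Q)\<close>, the
  right one of \<open>n\<close> blocks of format \<open>(Q, T)\<close>. Mixing the blocks with
  \<open>L i\<close> and \<open>R i\<close> before multiplying yields two-sided multiples of the
  \<open>n\<close> by \<open>n\<close> block matrix of the result, from which the left inverse
  \<open>c\<close> recovers all its blocks.\<close>

lemma mm_dims_reduce:
  fixes c :: "nat \<Rightarrow> nat \<Rightarrow> 'i \<Rightarrow> nat \<Rightarrow> nat \<Rightarrow> 'a::field"
  assumes fin: "finite I"
    and inv: "\<And>x y u v. x < n \<Longrightarrow> y < n \<Longrightarrow> u < n \<Longrightarrow> v < n \<Longrightarrow>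
      (\<Sum>i\<in>I. \<Sum>(a, b)\<in>{..<p i} \<times> {..<s i}. c x y i a b * (L i a u * R i v b)) = of_bool (x = u \<and> y = v)"
    and d: "\<And>i. i \<in> I \<Longrightarrow> mm_dims (UNIV :: 'a set) (p i * P) Q (s i * T) (\<rho> i)"
  shows "mm_dims (UNIV :: 'a set) (n * P) Q (n * T) (\<Sum>i\<in>I. \<rho> i)"
proof -
  have "\<exists>fgh. mm_decomp_by UNIV ({..<p i} \<times> {..<P}) {..<Q} ({..<s i} \<times> {..<T}) {..<\<rho> i}
      (fst fgh :: nat \<Rightarrow> _ \<Rightarrow> _ \<Rightarrow> 'a) (fst (snd fgh)) (snd (snd fgh))" if "i \<in> I" for i
  proof -
    have "mm_decomp (UNIV :: 'a set) ({..<p i} \<times> {..<P}) {..<Q} ({..<s i} \<times> {..<T}) (\<rho> i)"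
      by (rule mm_decomp_card_le[OF d[OF that]]) auto
    then obtain f g h where "mm_decomp_by (UNIV :: 'a set) ({..<p i} \<times> {..<P}) {..<Q} ({..<s i} \<times> {..<T}) {..<\<rho> i} f g h"
      unfolding mm_decomp_def by blast
    then show ?thesis
      by (intro exI[of _ "(f, g, h)"]) simp
  qed
  then obtain fgh where fgh: "\<And>i. i \<in> I \<Longrightarrow>
      mm_decomp_by UNIV ({..<p i} \<times> {..<P}) {..<Q} ({..<s i} \<times> {..<T}) {..<\<rho> i}
      (fst (fgh i) :: nat \<Rightarrow> _ \<Rightarrow> _ \<Rightarrow> 'a) (fst (snd (fgh i))) (snd (snd (fgh i)))"
    using bchoice[of I] by metis
  define f g h where "f i = fst (fgh i)" and "g i = fst (snd (fgh i))" and "h i = snd (snd (fgh i))" for i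
  have D: "mm_decomp_by UNIV ({..<p i} \<times> {..<P}) {..<Q} ({..<s i} \<times> {..<T}) {..<\<rho> i} (f i) (g i) (h i)"
    if "i \<in> I" for i
    using fgh[OF that] by (simp add: f_def g_def h_def)
  \<comment> \<open>The linear maps are absorbed into the coefficients: \<open>L\<close> into
    \<open>f\<close>, \<open>R\<close> into \<open>g\<close>, and the recovery \<open>c\<close> into
    \<open>h\<close>.\<close>
  define F where "F il x j = (\<Sum>a<p (fst il). L (fst il) a (fst x) * f (fst il) (snd il) (a, snd x) j)"
    for il :: "'i \<times> nat" and x :: "nat \<times> nat" and j
  define G where "G il j x = (\<Sum>b<s (fst il). R (fst il) (fst x) b * g (fst il) (snd il) j (b, snd x))"
    for il :: "'i \<times> nat" and x :: "nat \<times> nat" and j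
  define H where "H il x y = (\<Sum>(a, b)\<in>{..<p (fst il)} \<times> {..<s (fst il)}.
      c (fst x) (fst y) (fst il) a b * h (fst il) (snd il) (a, snd x) (b, snd y))"
    for il :: "'i \<times> nat" and x y :: "nat \<times> nat"
  let ?\<Lambda> = "SIGMA i:I. {..<\<rho> i}"
  have "mm_decomp (UNIV :: 'a set) ({..<n} \<times> {..<P}) {..<Q} ({..<n} \<times> {..<T}) (\<Sum>i\<in>I. \<rho> i)"
  proof (rule mm_decompI[where \<Lambda> = ?\<Lambda> and f = F and g = G and h = H])
    fix x j j' y x' y'
    assume *: "x \<in> {..<n} \<times> {..<P}" "j \<in> {..<Q}" "j' \<in> {..<Q}" "y \<in> {..<n} \<times> {..<T}"
      "x' \<in> {..<n} \<times> {..<P}" "y' \<in> {..<n} \<times> {..<T}"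
    let ?e = "of_bool (snd x = snd x' \<and> j = j' \<and> snd y = snd y') :: 'a"
    have one: "(\<Sum>l<\<rho> i. F (i, l) x j * G (i, l) j' y * h i l (a', snd x') (b', snd y'))
       = L i a' (fst x) * R i (fst y) b' * ?e"
      if i: "i \<in> I" and ab: "a' < p i" "b' < s i" for i a' b'
    proof -
      have "(\<Sum>l<\<rho> i. F (i, l) x j * G (i, l) j' y * h i l (a', snd x') (b', snd y'))
        = (\<Sum>l<\<rho> i. \<Sum>a<p i. \<Sum>b<s i. L i a (fst x) * R i (fst y) b *
            (f i l (a, snd x) j * g i l j' (b, snd y) * h i l (a', snd x') (b', snd y')))"
        unfolding F_def G_def sum_product by (simp add: sum_distrib_left mult_ac)
      also have "\<dots> = (\<Sum>a<p i. \<Sum>b<s i. \<Sum>l<\<rho> i. L i a (fst x) * R i (fst y) b *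
            (f i l (a, snd x) j * g i l j' (b, snd y) * h i l (a', snd x') (b', snd y')))"
        by (subst sum.swap, rule sum.cong[OF refl], rule sum.swap)
      also have "\<dots> = (\<Sum>a<p i. \<Sum>b<s i. of_bool (b = b') * (of_bool (a = a') * (L i a (fst x) * R i (fst y) b * ?e)))"
      proof (intro sum.cong refl)
        fix a b assume "a \<in> {..<p i}" "b \<in> {..<s i}"
        then have "(\<Sum>l<\<rho> i. f i l (a, snd x) j * g i l j' (b, snd y) * h i l (a', snd x') (b', snd y'))
          = of_bool ((a, snd x) = (a', snd x') \<and> j = j' \<and> (b, snd y) = (b', snd y'))"
          using * ab by (intro mm_decomp_by_eq[OF D[OF i]]) auto
        then show "(\<Sum>l<\<rho> i. L i a (fst x) * R i (fst y) b *
            (f i l (a, snd x) j * g i l j' (b, snd y) * h i l (a', snd x') (b', snd y')))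
          = of_bool (b = b') * (of_bool (a = a') * (L i a (fst x) * R i (fst y) b * ?e))"
          by (simp flip: sum_distrib_left)
      qed
      also have "\<dots> = (\<Sum>a<p i. of_bool (a = a') * (L i a (fst x) * R i (fst y) b' * ?e))"
        using ab by (subst sum_of_bool_mult) auto
      also have "\<dots> = L i a' (fst x) * R i (fst y) b' * ?e"
        using ab by (subst sum_of_bool_mult) auto
      finally show ?thesis .
    qed
    have "(\<Sum>il\<in>?\<Lambda>. F il x j * G il j' y * H il x' y')
      = (\<Sum>i\<in>I. \<Sum>l<\<rho> i. F (i, l) x j * G (i, l) j' y * H (i, l) x' y')"
      using fin by (subst sum.Sigma) (auto simp: case_prod_beta)
    also have "\<dots> = (\<Sum>i\<in>I. \<Sum>ab\<in>{..<p i} \<times> {..<s i}. c (fst x') (fst y') i (fst ab) (snd ab)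
        * (L i (fst ab) (fst x) * R i (fst y) (snd ab) * ?e))"
    proof (rule sum.cong[OF refl])
      fix i assume i: "i \<in> I"
      have "(\<Sum>l<\<rho> i. F (i, l) x j * G (i, l) j' y * H (i, l) x' y')
        = (\<Sum>l<\<rho> i. \<Sum>ab\<in>{..<p i} \<times> {..<s i}. c (fst x') (fst y') i (fst ab) (snd ab)
            * (F (i, l) x j * G (i, l) j' y * h i l (fst ab, snd x') (snd ab, snd y')))"
        unfolding H_def by (simp add: case_prod_beta sum_distrib_left mult_ac)
      also have "\<dots> = (\<Sum>ab\<in>{..<p i} \<times> {..<s i}. c (fst x') (fst y') i (fst ab) (snd ab)
            * (\<Sum>l<\<rho> i. F (i, l) x j * G (i, l) j' y * h i l (fst ab, snd x') (snd ab, snd y')))"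
        by (subst sum.swap) (simp add: sum_distrib_left)
      also have "\<dots> = (\<Sum>ab\<in>{..<p i} \<times> {..<s i}. c (fst x') (fst y') i (fst ab) (snd ab)
        * (L i (fst ab) (fst x) * R i (fst y) (snd ab) * ?e))"
        using i by (intro sum.cong refl arg_cong2[where f = "(*)"] one) auto
      finally show "(\<Sum>l<\<rho> i. F (i, l) x j * G (i, l) j' y * H (i, l) x' y')
        = (\<Sum>ab\<in>{..<p i} \<times> {..<s i}. c (fst x') (fst y') i (fst ab) (snd ab)
        * (L i (fst ab) (fst x) * R i (fst y) (snd ab) * ?e))" .
    qed
    also have "\<dots> = (\<Sum>i\<in>I. \<Sum>(a, b)\<in>{..<p i} \<times> {..<s i}.
          c (fst x') (fst y') i a b * (L i a (fst x) * R i (fst y) b)) * ?e"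
      by (simp add: sum_distrib_right case_prod_beta mult.assoc)
    also have "\<dots> = of_bool (fst x' = fst x \<and> fst y' = fst y) * ?e"
      using * by (subst inv) auto
    also have "\<dots> = of_bool (x = x' \<and> j = j' \<and> y = y')"
      by (auto simp: prod_eq_iff)
    finally show "(\<Sum>il\<in>?\<Lambda>. F il x j * G il j' y * H il x' y') = of_bool (x = x' \<and> j = j' \<and> y = y')" .
  qed (use fin in auto)
  then show ?thesis
    by (rule mm_decomp_card_le) auto
qed

text \<open>Unrolling \<open>reduce\<close> gives one branch per word of length \<open>m\<close>
  over \<open>I\<close>. Only the multiplicities \<open>c\<close> of the letters matter, and the
  induction carries them as a parameter. At the end \<open>base\<close> treats all equal factors at
  once, so its constant enters \<open>card I\<close> times, independently of
  \<open>m\<close>.\<close>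

lemma mm_dims_power_bound:
  fixes p s :: "'i \<Rightarrow> nat" and y :: "'i \<Rightarrow> real"
  assumes fin: "finite I" and C: "C \<ge> 0" and y: "\<And>i. i \<in> I \<Longrightarrow> y i \<ge> 0"
    and reduce: "\<And>P Q T \<rho>. (\<And>i. i \<in> I \<Longrightarrow> mm_dims (UNIV :: 'a::field set) (p i * P) Q (s i * T) (\<rho> i)) \<Longrightarrow>
        mm_dims (UNIV :: 'a set) (n * P) Q (n * T) (\<Sum>i\<in>I. \<rho> i)"
    and base: "\<And>i c. i \<in> I \<Longrightarrow> \<exists>R. mm_dims (UNIV :: 'a set) (p i ^ c) (n ^ c) (s i ^ c) R \<and> real R \<le> C * y i ^ c"
  shows "\<exists>R. mm_dims (UNIV :: 'a set) (n ^ m * (\<Prod>i\<in>I. p i ^ c i)) (n ^ (m + (\<Sum>i\<in>I. c i))) (n ^ m * (\<Prod>i\<in>I. s i ^ c i)) R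
     \<and> real R \<le> C ^ card I * (\<Sum>i\<in>I. y i) ^ m * (\<Prod>i\<in>I. y i ^ c i)"
proof (induction m arbitrary: c)
  case 0
  have "\<exists>R. mm_dims (UNIV :: 'a set) (\<Prod>i\<in>J. p i ^ c i) (n ^ (\<Sum>i\<in>J. c i)) (\<Prod>i\<in>J. s i ^ c i) R
     \<and> real R \<le> C ^ card J * (\<Prod>i\<in>J. y i ^ c i)" if "finite J" "J \<subseteq> I" for J
    using that
  proof (induction J rule: finite_induct)
    case empty
    show ?case
      using mm_decomp_subset[OF mm_dims_1, of UNIV] by (intro exI[of _ 1]) simp
  next
    case (insert i J)
    then obtain R where R: "mm_dims (UNIV :: 'a set) (\<Prod>i\<in>J. p i ^ c i) (n ^ (\<Sum>i\<in>J. c i)) (\<Prod>i\<in>J. s i ^ c i) R"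
      "real R \<le> C ^ card J * (\<Prod>i\<in>J. y i ^ c i)" by auto
    obtain R' where R': "mm_dims (UNIV :: 'a set) (p i ^ c i) (n ^ c i) (s i ^ c i) R'" "real R' \<le> C * y i ^ c i"
      using base[of i "c i"] insert.prems by auto
    have "real (R' * R) \<le> (C * y i ^ c i) * (C ^ card J * (\<Prod>i\<in>J. y i ^ c i))"
      unfolding of_nat_mult using R R' C y insert.prems by (intro mult_mono) auto
    then show ?case
      using mm_dims_mult_UNIV[OF R'(1) R(1)] insert.hyps
      by (intro exI[of _ "R' * R"]) (simp add: power_add mult_ac)
  qed
  from this[OF fin subset_refl] show ?case by simp
next
  case (Suc m)
  let ?B = "C ^ card I * (\<Sum>i\<in>I. y i) ^ m * (\<Prod>i\<in>I. y i ^ c i)"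
  let ?p = "n ^ m * (\<Prod>i\<in>I. p i ^ c i)" and ?q = "n ^ (Suc m + (\<Sum>i\<in>I. c i))" and ?s = "n ^ m * (\<Prod>i\<in>I. s i ^ c i)"
  \<comment> \<open>Entering branch \<open>i\<close> raises the multiplicity of \<open>i\<close> by
    one, which accounts for the factor \<open>p i\<close>, \<open>s i\<close> or
    \<open>y i\<close>.\<close>
  have bump: "(\<Prod>j\<in>I. z j ^ (c(i := Suc (c i))) j) = z i * (\<Prod>j\<in>I. z j ^ c j)" if "i \<in> I" for i and z :: "'i \<Rightarrow> 'z::comm_monoid_mult"
  proof -
    have "(\<Prod>j\<in>I - {i}. z j ^ (c(i := Suc (c i))) j) = (\<Prod>j\<in>I - {i}. z j ^ c j)"
      by (rule prod.cong) auto
    then show ?thesis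
      unfolding prod.remove[OF fin that, of "\<lambda>j. z j ^ c j"] prod.remove[OF fin that, of "\<lambda>j. z j ^ (c(i := Suc (c i))) j"]
      by (simp add: mult.assoc)
  qed
  have bump_sum: "(\<Sum>j\<in>I. (c(i := Suc (c i))) j) = Suc (\<Sum>j\<in>I. c j)" if "i \<in> I" for i
  proof -
    have "(\<Sum>j\<in>I - {i}. (c(i := Suc (c i))) j) = (\<Sum>j\<in>I - {i}. c j)"
      by (rule sum.cong) auto
    then show ?thesis
      unfolding sum.remove[OF fin that, of c] sum.remove[OF fin that, of "c(i := Suc (c i))"] by simp
  qed
  have step: "\<exists>R. mm_dims (UNIV :: 'a set) (p i * ?p) ?q (s i * ?s) R \<and> real R \<le> y i * ?B" if "i \<in> I" for i
    using Suc.IH[of "c(i := Suc (c i))"] unfolding bump[OF that] bump_sum[OF that]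
    by (simp add: mult_ac)
  define \<rho> where "\<rho> i = (SOME R. mm_dims (UNIV :: 'a set) (p i * ?p) ?q (s i * ?s) R \<and> real R \<le> y i * ?B)" for i
  have \<rho>: "mm_dims (UNIV :: 'a set) (p i * ?p) ?q (s i * ?s) (\<rho> i)" "real (\<rho> i) \<le> y i * ?B" if "i \<in> I" for i
    using someI_ex[OF step[OF that]] unfolding \<rho>_def by simp_all
  have "real (\<Sum>i\<in>I. \<rho> i) \<le> (\<Sum>i\<in>I. y i * ?B)"
    unfolding of_nat_sum by (rule sum_mono) (rule \<rho>)
  also have "\<dots> = C ^ card I * (\<Sum>i\<in>I. y i) ^ Suc m * (\<Prod>i\<in>I. y i ^ c i)"
    by (simp add: sum_distrib_right[symmetric] mult_ac)
  finally show ?case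
    using reduce[OF \<rho>(1)] by (intro exI[of _ "\<Sum>i\<in>I. \<rho> i"]) (simp add: mult_ac)
qed

section \<open>Exponents of rectangular matrix multiplication\<close>

definition omega_exponents :: "'f::field itself \<Rightarrow> real \<Rightarrow> real \<Rightarrow> real \<Rightarrow> real set" where
  "omega_exponents F a b c = {w. w > 0 \<and>
     (\<exists>s :: nat \<Rightarrow> nat. (\<lambda>n. real (s n)) \<in> O(\<lambda>n. real n powr w) \<and>
        (\<forall>n. matmul_in F (dim_pow n a) (dim_pow n b) (dim_pow n c) (s n)))}"

lemma omega_rect_eq_Inf: "omega_rect F a b c = Inf (omega_exponents F a b c)"
  unfolding omega_rect_def omega_exponents_def by simp

lemma omega_rect_le: "w \<in> omega_exponents F a b c \<Longrightarrow> omega_rect F a b c \<le> w"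
  unfolding omega_rect_eq_Inf
  by (rule cInf_lower) (auto intro!: bdd_belowI[of _ 0] simp: omega_exponents_def)

lemma rf_const_0_mem: "(0 :: 'f::field ratfun) \<in> range rf_const"
  using rf_const_simps(1) by (metis rangeI)

text \<open>Asymptotically \<open>n = 0\<close> is irrelevant, but a program must be supplied for
  it, because the definition asks for one at every \<open>n\<close>.\<close>

lemma omega_exponentsI:
  assumes w: "w > 0"
    and s: "\<And>n. n \<ge> 1 \<Longrightarrow> \<exists>s. matmul_in TYPE('f::field) (dim_pow n a) (dim_pow n b) (dim_pow n c) s \<and> real s \<le> C * real n powr w"
  shows "w \<in> omega_exponents TYPE('f) a b c"
proof -
  have "\<exists>s. matmul_in TYPE('f) (dim_pow n a) (dim_pow n b) (dim_pow n c) s \<and> (n \<ge> 1 \<longrightarrow> real s \<le> C * real n powr w)" for n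
  proof (cases "n \<ge> 1")
    case False
    then have "n = 0" by simp
    then show ?thesis
      using matmul_in_if_mult_cost[OF mult_cost_naive[OF rf_const_0_mem]] by (auto simp: dim_pow_def)
  qed (use s in blast)
  then obtain s where s: "\<And>n. matmul_in TYPE('f) (dim_pow n a) (dim_pow n b) (dim_pow n c) (s n)"
    "\<And>n. n \<ge> 1 \<Longrightarrow> real (s n) \<le> C * real n powr w"
    by metis
  have "(\<lambda>n. real (s n)) \<in> O(\<lambda>n. real n powr w)"
    by (rule bigoI[where c = C], rule eventually_sequentiallyI[of 1]) (use s(2) in simp)
  then show ?thesis
    unfolding omega_exponents_def using w s(1) by blast
qed

text \<open>The asymptotic bound is made uniform, as it will be applied to all powers of a fixed
  number, small ones included.\<close>

lemma omega_exponentsD: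
  assumes "w \<in> omega_exponents TYPE('f::field) a b c"
  shows "\<exists>C>0. \<forall>n\<ge>1. \<exists>s. matmul_in TYPE('f) (dim_pow n a) (dim_pow n b) (dim_pow n c) s \<and> real s \<le> C * real n powr w"
proof -
  from assms obtain s where w: "w > 0" and s: "(\<lambda>n. real (s n)) \<in> O(\<lambda>n. real n powr w)"
    "\<And>n. matmul_in TYPE('f) (dim_pow n a) (dim_pow n b) (dim_pow n c) (s n)"
    unfolding omega_exponents_def by blast
  from landau_o.bigE[OF s(1)] obtain C where C: "C > 0"
    "eventually (\<lambda>n. norm (real (s n)) \<le> C * norm (real n powr w)) at_top"
    by metis
  then obtain n0 where n0: "\<And>n. n \<ge> n0 \<Longrightarrow> real (s n) \<le> C * real n powr w"
    by (auto simp: eventually_sequentially)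
  \<comment> \<open>The finitely many early costs are added to the constant; this suffices because
    \<open>real n powr w \<ge> 1\<close> for \<open>n \<ge> 1\<close>.\<close>
  define C' where "C' = C + (\<Sum>n<n0. real (s n))"
  have "real (s n) \<le> C' * real n powr w" if "n \<ge> 1" for n
  proof -
    have pw: "real n powr w \<ge> 1"
      using that w by (simp add: ge_one_powr_ge_zero)
    show ?thesis
    proof (cases "n \<ge> n0")
      case True
      have "C * real n powr w \<le> C' * real n powr w"
        by (intro mult_right_mono) (auto simp: C'_def sum_nonneg)
      then show ?thesis using n0[OF True] by simp
    next
      case False
      then have "real (s n) \<le> (\<Sum>n<n0. real (s n))"
        by (intro member_le_sum) auto
      then have "real (s n) \<le> C' * 1"
        using C(1) by (simp add: C'_def)
      also have "\<dots> \<le> C' * real n powr w"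
        using pw C(1) by (intro mult_left_mono) (auto simp: C'_def intro!: add_nonneg_nonneg sum_nonneg)
      finally show ?thesis .
    qed
  qed
  moreover have "C' > 0"
    using C(1) by (auto simp: C'_def intro!: add_pos_nonneg sum_nonneg)
  ultimately show ?thesis
    using s(2) by blast
qed

lemma of_nat_dim_pow_le: "real (dim_pow n a) \<le> real n powr a"
  by (simp add: dim_pow_def)

lemma dim_pow_1 [simp]: "dim_pow n 1 = n"
  by (simp add: dim_pow_def)

lemma dim_pow_le: "a \<le> 1 \<Longrightarrow> dim_pow n a \<le> n"
proof (cases "n \<ge> 1")
  case True
  assume "a \<le> 1"
  then have "real n powr a \<le> real n powr 1"
    using True by (intro powr_mono) auto
  then have "real (dim_pow n a) \<le> real n"
    using of_nat_dim_pow_le[of n a] by simp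
  then show ?thesis by simp
qed (simp add: dim_pow_def not_le)

text \<open>Nonemptiness of the set of exponents, so that its infimum is approximated by
  members.\<close>

lemma naive_exponent:
  assumes "a \<le> 1" "b \<le> 1" "c \<le> 1"
  shows "3 \<in> omega_exponents TYPE('f::field) a b c"
proof (rule omega_exponentsI[where C = 2])
  fix n :: nat assume "n \<ge> 1"
  let ?s = "dim_pow n a * dim_pow n c * (2 * dim_pow n b)"
  have "?s \<le> n * n * (2 * n)"
    using assms by (intro mult_mono dim_pow_le) auto
  then have "real ?s \<le> real (n * n * (2 * n))"
    by (rule of_nat_mono)
  then have "real ?s \<le> 2 * real n powr 3"
    using \<open>n \<ge> 1\<close> by (simp add: powr_numeral power3_eq_cube)
  then show "\<exists>s. matmul_in TYPE('f) (dim_pow n a) (dim_pow n b) (dim_pow n c) s \<and> real s \<le> 2 * real n powr 3"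
    using matmul_in_if_mult_cost[OF mult_cost_naive[OF rf_const_0_mem]] by blast
qed simp

lemma omega_rect_approx:
  assumes "a \<le> 1" "b \<le> 1" "c \<le> 1" "\<epsilon> > 0"
  shows "\<exists>w\<in>omega_exponents TYPE('f::field) a b c. w < omega_rect TYPE('f) a b c + \<epsilon>"
  unfolding omega_rect_eq_Inf
  by (rule cInf_lessD) (use naive_exponent[OF assms(1-3)] assms(4) in auto)

lemma Suc_le_const_mult_power:
  assumes "(x::real) > 1"
  shows "\<exists>K>0. \<forall>u. 1 + real u \<le> K * x ^ u"
\<comment> \<open>The constant times the Bernoulli bound \<open>1 + u * (x - 1)\<close> expands to
  \<open>1 + u\<close> plus nonnegative terms.\<close>
proof (intro exI[of _ "1 + 1 / (x - 1)"] conjI allI)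
  show "1 + 1 / (x - 1) > 0"
    using assms by (intro add_pos_pos) auto
  fix u
  have "1 + real u * (x - 1) \<le> x ^ u"
    using Bernoulli_inequality[of "x - 1" u] assms by (simp add: mult.commute)
  then have "(1 + 1 / (x - 1)) * (1 + real u * (x - 1)) \<le> (1 + 1 / (x - 1)) * x ^ u"
    using assms by (intro mult_left_mono) auto
  moreover have "(1 + 1 / (x - 1)) * (1 + real u * (x - 1)) = 1 + real u + real u * (x - 1) + 1 / (x - 1)"
    using assms by (simp add: field_simps)
  moreover have "0 \<le> real u * (x - 1) + 1 / (x - 1)"
    using assms by simp
  ultimately show "1 + real u \<le> (1 + 1 / (x - 1)) * x ^ u" by linarith
qed

section \<open>From ranks to exponents\<close>

text \<open>A single decomposition serves all \<open>n\<close>: with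
  \<open>N ^ u \<le> n < N ^ (u + 1)\<close>, its \<open>u\<close>-th power is applied to blocks of
  side \<open>A\<close>. The blocks make up for the gap between \<open>N ^ u\<close> and
  \<open>n\<close> and for the loss \<open>\<delta>\<close> in each dimension; treating them naively
  costs about \<open>A ^ 3\<close>, whence \<open>3 * \<delta>\<close>.\<close>

lemma omega_exponent_if_rank:
  assumes N: "N \<ge> 2" and d: "mm_dims (UNIV :: 'f::field set) P Q R \<rho>"
    and abc: "a \<le> 1" "b \<le> 1" "c \<le> 1" "0 \<le> a" "0 \<le> b" "0 \<le> c" and \<delta>: "\<delta> \<ge> 0"
    and P: "real P \<ge> real N powr (a - \<delta>)" and Q: "real Q \<ge> real N powr (b - \<delta>)"
    and R: "real R \<ge> real N powr (c - \<delta>)"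
    and \<rho>: "real \<rho> \<le> real N powr w" and w': "w' > w + 3 * \<delta>"
  shows "w' \<in> omega_exponents TYPE('f) a b c"
proof -
  have N0: "real N > 1" using N by simp
  have pos: "P > 0" "Q > 0" "R > 0"
    using P Q R N0 by (auto intro!: gr0I simp: powr_eq_0_iff)
  \<comment> \<open>Membership in the set of exponents demands \<open>w' > 0\<close>, which rests on
    the rank being at least 1.\<close>
  have "1 \<le> P * Q" using pos by (simp add: Suc_le_eq)
  then have \<rho>1: "\<rho> \<ge> 1" using mm_dims_rank_ge(1)[OF d pos] by linarith
  have "1 \<le> real N powr w" using \<rho> \<rho>1 by linarith
  then have w0: "w \<ge> 0"
    using N0 by (metis not_less powr_less_one less_le_trans)
  have w'0: "w' > 0" using w0 w' \<delta> by simp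
  let ?C = "range (rf_const :: 'f \<Rightarrow> 'f ratfun)"
  have dK: "mm_dims ?C P Q R \<rho>"
    by (rule mm_decomp_map[OF d]) (simp_all add: rf_const_simps)
  \<comment> \<open>The slack of the exponent absorbs the factor linear in \<open>u\<close> from the
    block recursion.\<close>
  define \<epsilon> where "\<epsilon> = w' - w - 3 * \<delta>"
  have \<epsilon>: "\<epsilon> > 0" using w' by (simp add: \<epsilon>_def)
  have "real N powr \<epsilon> > 1" using \<epsilon> N0 by simp
  then obtain K where K: "K > 0" "\<And>u. 1 + real u \<le> K * (real N powr \<epsilon>) ^ u"
    using Suc_le_const_mult_power by blast
  define C where "C = (2 + 6 * real \<rho>) * K * (8 * real N powr 3)"
  show ?thesis
  proof (rule omega_exponentsI[OF w'0, of _ _ _ C])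
    fix n :: nat assume n: "n \<ge> 1"
    obtain u where u: "N ^ u \<le> n" "n < N ^ (u + 1)"
      using ex_power_ivl1[OF N n] by blast
    \<comment> \<open>The summand \<open>\<delta> * real u\<close> compensates \<open>u\<close>
      losses of \<open>\<delta>\<close>, the summand 1 the step from \<open>N ^ u\<close> up to
      \<open>N ^ (u + 1)\<close>.\<close>
    define A where "A = nat \<lceil>real N powr (1 + \<delta> * real u)\<rceil>"
    have A_ge: "real A \<ge> real N powr (1 + \<delta> * real u)"
      unfolding A_def by (simp add: real_nat_ceiling_ge)
    have "real N powr (1 + \<delta> * real u) \<ge> 1"
      using N0 \<delta> by (intro ge_one_powr_ge_zero) auto
    then have A_le: "real A \<le> 2 * real N powr (1 + \<delta> * real u)" and A_pos: "A > 0"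
      unfolding A_def by linarith+
    have dim: "dim_pow n z \<le> Z ^ u * A" if z: "0 \<le> z" "z \<le> 1" and Z: "real Z \<ge> real N powr (z - \<delta>)" for z Z
    proof -
      have "real n \<le> real N ^ (u + 1)"
        using u(2) by (metis of_nat_le_iff of_nat_power less_imp_le)
      then have "real n powr z \<le> (real N ^ (u + 1)) powr z"
        using z by (intro powr_mono2) auto
      also have "\<dots> = real N powr (real (u + 1) * z)"
        using N0 by (subst powr_realpow[symmetric]) (auto simp: powr_powr)
      also have "\<dots> \<le> real N powr ((z - \<delta>) * real u + (1 + \<delta> * real u))"
        using N0 z by (intro powr_mono) (auto simp: algebra_simps)
      also have "\<dots> = (real N powr (z - \<delta>)) ^ u * real N powr (1 + \<delta> * real u)"
        using N0 by (simp add: powr_add powr_powr[symmetric] powr_realpow)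
      also have "\<dots> \<le> real Z ^ u * real A"
        using Z A_ge by (intro mult_mono power_mono) auto
      finally have "real (dim_pow n z) \<le> real (Z ^ u * A)"
        using of_nat_dim_pow_le[of n z] by simp
      then show ?thesis by (simp only: of_nat_le_iff)
    qed
    let ?s = "(2 + 6 * \<rho> * u) * \<rho> ^ u * (A * A * A)"
    have "mult_cost ?C (P ^ u * A) (Q ^ u * A) (R ^ u * A) ?s"
      by (rule mult_cost_power[OF dK rf_const_0_mem pos A_pos A_pos A_pos])
    then have "mult_cost ?C (dim_pow n a) (dim_pow n b) (dim_pow n c) ?s"
      by (rule mult_cost_pad[OF rf_const_0_mem]) (use abc P Q R in \<open>auto intro!: dim\<close>)
    then have "matmul_in TYPE('f) (dim_pow n a) (dim_pow n b) (dim_pow n c) ?s"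
      by (rule matmul_in_if_mult_cost)
    moreover have "real ?s \<le> C * real n powr w'"
    proof -
      have 1: "real (2 + 6 * \<rho> * u) \<le> (2 + 6 * real \<rho>) * (K * (real N powr \<epsilon>) ^ u)"
      proof -
        have "real (2 + 6 * \<rho> * u) \<le> (2 + 6 * real \<rho>) * (1 + real u)"
          by (simp add: algebra_simps)
        also have "\<dots> \<le> (2 + 6 * real \<rho>) * (K * (real N powr \<epsilon>) ^ u)"
          using K(2) by (intro mult_left_mono) auto
        finally show ?thesis .
      qed
      have 2: "real (\<rho> ^ u) \<le> (real N powr w) ^ u"
        unfolding of_nat_power using \<rho> by (intro power_mono) auto
      have 3: "real (A * A * A) \<le> 8 * real N powr 3 * (real N powr (3 * \<delta>)) ^ u"
      proof -
        have "real (A * A * A) \<le> (2 * real N powr (1 + \<delta> * real u)) * (2 * real N powr (1 + \<delta> * real u)) * (2 * real N powr (1 + \<delta> * real u))"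
          unfolding of_nat_mult using A_le by (intro mult_mono) auto
        also have "\<dots> = 8 * real N powr ((1 + \<delta> * real u) + (1 + \<delta> * real u) + (1 + \<delta> * real u))"
          by (simp only: powr_add)
        also have "(1 + \<delta> * real u) + (1 + \<delta> * real u) + (1 + \<delta> * real u) = 3 + (3 * \<delta>) * real u"
          by (simp add: algebra_simps)
        also have "8 * real N powr (3 + (3 * \<delta>) * real u) = 8 * real N powr 3 * (real N powr (3 * \<delta>)) ^ u"
          using N0 by (simp add: powr_add powr_powr[symmetric] powr_realpow)
        finally show ?thesis .
      qed
      have "real ?s \<le> (2 + 6 * real \<rho>) * (K * (real N powr \<epsilon>) ^ u) * (real N powr w) ^ u * (8 * real N powr 3 * (real N powr (3 * \<delta>)) ^ u)"
        unfolding of_nat_mult[of "_ * _" "A * A * A"] of_nat_mult[of _ "\<rho> ^ u"]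
        using 1 2 3 K by (intro mult_mono) auto
      also have "\<dots> = C * (real N powr \<epsilon> * real N powr w * real N powr (3 * \<delta>)) ^ u"
        by (simp add: C_def power_mult_distrib)
      also have "real N powr \<epsilon> * real N powr w * real N powr (3 * \<delta>) = real N powr w'"
        by (simp add: powr_add[symmetric] \<epsilon>_def)
      also have "(real N powr w') ^ u = real (N ^ u) powr w'"
        using N0 by (simp add: powr_realpow[symmetric] powr_powr mult.commute)
      also have "C * \<dots> \<le> C * real n powr w'"
        using u(1) w'0 K by (intro mult_left_mono powr_mono2) (auto simp: C_def simp del: of_nat_power)
      finally show ?thesis .
    qed
    ultimately show "\<exists>s. matmul_in TYPE('f) (dim_pow n a) (dim_pow n b) (dim_pow n c) s \<and> real s \<le> C * real n powr w'"
      by blast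
  qed
qed

lemma poly_le_power_eventually:
  assumes "(x::real) > 1"
  shows "\<exists>t\<ge>1. real (t + 1) ^ e \<le> x ^ t"
proof -
  \<comment> \<open>As \<open>y ^ Suc e = x\<close>, \<open>e\<close> of the factors
    \<open>y ^ t\<close> dominate the polynomial up to the constant \<open>K ^ e\<close>, and the
    last one dominates that constant.\<close>
  define y where "y = root (Suc e) x"
  have y: "y > 1" "y ^ Suc e = x"
    using assms real_root_pow_pos2[of "Suc e" x] unfolding y_def by simp_all
  obtain K where K: "K > 0" "\<And>u. 1 + real u \<le> K * y ^ u"
    using Suc_le_const_mult_power[OF y(1)] by blast
  obtain t0 where t0: "K ^ e < y ^ t0"
    using real_arch_pow[OF y(1)] by blast
  define t where "t = Suc t0"
  have "y ^ t0 \<le> y ^ t"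
    using y(1) by (intro power_increasing) (auto simp: t_def)
  then have "K ^ e \<le> y ^ t"
    using t0 by linarith
  have "real (t + 1) ^ e \<le> (K * y ^ t) ^ e"
    using K(2)[of t] by (intro power_mono) auto
  also have "\<dots> = K ^ e * (y ^ t) ^ e"
    by (simp add: power_mult_distrib)
  also have "\<dots> \<le> y ^ t * (y ^ t) ^ e"
    using \<open>K ^ e \<le> y ^ t\<close> y by (intro mult_right_mono) auto
  also have "\<dots> = (y ^ Suc e) ^ t"
    by (simp add: power_mult_distrib power_mult[symmetric] mult.commute)
  finally show ?thesis
    unfolding y(2) by (intro exI[of _ t]) (simp add: t_def)
qed

text \<open>A high power is taken before descending: relative to the base \<open>N ^ t\<close>, the
  polynomial factor raises the exponent by at most \<open>\<epsilon>\<close>.\<close>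

lemma omega_exponent_if_ratfun_rank:
  assumes N: "N \<ge> 2" and d: "mm_dims (UNIV :: 'f::field ratfun set) P Q R \<rho>"
    and abc: "a \<le> 1" "b \<le> 1" "c \<le> 1" "0 \<le> a" "0 \<le> b" "0 \<le> c" and \<delta>: "\<delta> \<ge> 0"
    and P: "real P \<ge> real N powr (a - \<delta>)" and Q: "real Q \<ge> real N powr (b - \<delta>)"
    and R: "real R \<ge> real N powr (c - \<delta>)"
    and \<rho>: "real \<rho> \<le> real N powr w" and w': "w' > w + 3 * \<delta>"
  shows "w' \<in> omega_exponents TYPE('f) a b c"
proof -
  \<comment> \<open>Half of the slack pays for the descent, the other half keeps the inequality
    strict.\<close>
  define \<epsilon> where "\<epsilon> = (w' - w - 3 * \<delta>) / 2"
  have \<epsilon>: "\<epsilon> > 0" "w' > w + \<epsilon> + 3 * \<delta>" using w' by (simp_all add: \<epsilon>_def field_simps)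
  obtain e where e: "\<And>t. \<exists>R'\<le>\<rho> ^ t * (t + 1) ^ e. mm_dims (UNIV :: 'f set) (P ^ t) (Q ^ t) (R ^ t) R'"
    using mm_dims_ratfun_power_descend[OF d] by blast
  have N0: "real N > 1" using N by simp
  then have "real N powr \<epsilon> > 1" using \<epsilon> by simp
  then obtain t where t: "t \<ge> 1" "real (t + 1) ^ e \<le> (real N powr \<epsilon>) ^ t"
    using poly_le_power_eventually by blast
  obtain R' where R': "R' \<le> \<rho> ^ t * (t + 1) ^ e" "mm_dims (UNIV :: 'f set) (P ^ t) (Q ^ t) (R ^ t) R'"
    using e by blast
  have pow: "real (N ^ t) powr z = (real N powr z) ^ t" for z
    using N0 by (simp add: powr_realpow[symmetric] powr_powr mult.commute)
  have pow_ge: "real (Z ^ t) \<ge> real (N ^ t) powr z" if "real Z \<ge> real N powr z" for Z z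
    unfolding pow unfolding of_nat_power by (rule power_mono[OF that]) simp
  have "N \<le> N ^ t" using t(1) N by (simp add: self_le_power)
  then have Nt: "N ^ t \<ge> 2" using N by linarith
  show ?thesis
  proof (rule omega_exponent_if_rank[OF Nt R'(2) abc \<delta> _ _ _ _ \<epsilon>(2)])
    show "real (P ^ t) \<ge> real (N ^ t) powr (a - \<delta>)" "real (Q ^ t) \<ge> real (N ^ t) powr (b - \<delta>)"
      "real (R ^ t) \<ge> real (N ^ t) powr (c - \<delta>)"
      by (rule pow_ge[OF P] pow_ge[OF Q] pow_ge[OF R])+
    have "real R' \<le> real (\<rho> ^ t * (t + 1) ^ e)"
      using R'(1) by (rule of_nat_mono)
    also have "\<dots> = real \<rho> ^ t * real (t + 1) ^ e" by simp
    also have "\<dots> \<le> (real N powr w) ^ t * (real N powr \<epsilon>) ^ t"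
      using \<rho> t(2) by (intro mult_mono power_mono) auto
    also have "\<dots> = real (N ^ t) powr (w + \<epsilon>)"
      by (simp only: pow power_mult_distrib powr_add)
    finally show "real R' \<le> real (N ^ t) powr (w + \<epsilon>)" .
  qed
qed

text \<open>Rounding down a number that is at least 1 loses at most a factor 2, which
  \<open>real n powr \<delta>\<close> absorbs.\<close>

lemma dim_pow_ge:
  assumes n: "n \<ge> 1" "real n powr \<delta> \<ge> 2" and a: "a \<ge> 0"
  shows "real (dim_pow n a) \<ge> real n powr (a - \<delta>)"
proof -
  have 1: "real n powr a \<ge> 1"
    using n a by (simp add: ge_one_powr_ge_zero)
  have "real n powr (a - \<delta>) = real n powr a / real n powr \<delta>"
    by (simp add: powr_diff)
  also have "\<dots> \<le> real n powr a / 2"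
    using n by (intro divide_left_mono) auto
  also have "\<dots> \<le> real (dim_pow n a)"
  proof -
    have "\<lfloor>real n powr a\<rfloor> \<ge> 1" using 1 by simp
    then have "real (dim_pow n a) = of_int \<lfloor>real n powr a\<rfloor>" and "of_int \<lfloor>real n powr a\<rfloor> \<ge> (1::real)"
      by (simp_all add: dim_pow_def)
    then show ?thesis
      using floor_correct[of "real n powr a"] by linarith
  qed
  finally show ?thesis .
qed

lemma powr_unbounded_nat:
  assumes "\<delta> > 0"
  shows "\<exists>N\<ge>2. real N powr \<delta> \<ge> B"
proof -
  define N where "N = nat \<lceil>max 2 (max 1 B powr (1 / \<delta>))\<rceil>"
  have N: "real N \<ge> max 2 (max 1 B powr (1 / \<delta>))"
    unfolding N_def by (rule real_nat_ceiling_ge)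
  have "B \<le> max 1 B" by simp
  also have "\<dots> = (max 1 B powr (1 / \<delta>)) powr \<delta>"
    using assms by (simp add: powr_powr)
  also have "\<dots> \<le> real N powr \<delta>"
    using N assms by (intro powr_mono2) auto
  finally show ?thesis
    using N by (intro exI[of _ N]) auto
qed

text \<open>Costs are compared through ranks, which are monotone in the format and invariant under
  transposition: the format with exponents \<open>(1, 1, min a b)\<close> contains that with
  \<open>(a, 1, b)\<close>, after a transposition if \<open>a \<le> b\<close>.\<close>

lemma omega_rect_le_omega_rect_min:
  assumes a: "0 \<le> a" "a \<le> 1" and b: "0 \<le> b" "b \<le> 1"
  shows "omega_rect TYPE('f::field) a 1 b \<le> omega_rect TYPE('f) 1 1 (min a b)"
proof -
  have "omega_rect TYPE('f) a 1 b \<le> w" if w: "w \<in> omega_exponents TYPE('f) 1 1 (min a b)" for w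
  proof (rule dense_ge)
    fix w' assume "w < w'"
    \<comment> \<open>Of the five parts, one covers the constant \<open>2 * C\<close>, three cover
      the rounding of dimensions, and one keeps the inequality strict.\<close>
    define \<delta> where "\<delta> = (w' - w) / 5"
    have \<delta>: "\<delta> > 0" "w' > (w + \<delta>) + 3 * \<delta>" using \<open>w < w'\<close> by (simp_all add: \<delta>_def field_simps)
    obtain C where C: "C > 0" "\<And>n. n \<ge> 1 \<Longrightarrow> \<exists>s. matmul_in TYPE('f) n n (dim_pow n (min a b)) s \<and> real s \<le> C * real n powr w"
      using omega_exponentsD[OF w] by auto
    obtain N where N: "N \<ge> 2" "real N powr \<delta> \<ge> max 2 (2 * C)"
      using powr_unbounded_nat[OF \<delta>(1)] by blast
    obtain s where s: "matmul_in TYPE('f) N N (dim_pow N (min a b)) s" "real s \<le> C * real N powr w"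
      using C(2)[of N] N by auto
    obtain \<rho> where \<rho>: "\<rho> \<le> 2 * s" "mm_dims (UNIV :: 'f ratfun set) N N (dim_pow N (min a b)) \<rho>"
      using matmul_in_imp_mm_dims[OF s(1)] by blast
    have d: "mm_dims (UNIV :: 'f ratfun set) (dim_pow N a) N (dim_pow N b) \<rho>"
    proof (cases "a \<le> b")
      case True
      then have "mm_dims (UNIV :: 'f ratfun set) (dim_pow N a) N N \<rho>"
        using mm_decomp_transpose[OF \<rho>(2)] by (simp add: min_def)
      then show ?thesis by (rule mm_dims_mono) (use b in \<open>auto intro: dim_pow_le\<close>)
    next
      case False
      then have "mm_dims (UNIV :: 'f ratfun set) N N (dim_pow N b) \<rho>"
        using \<rho>(2) by (simp add: min_def)
      then show ?thesis by (rule mm_dims_mono) (use a in \<open>auto intro: dim_pow_le\<close>)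
    qed
    have "real \<rho> \<le> 2 * real s" using \<rho>(1) by linarith
    also have "\<dots> \<le> (2 * C) * real N powr w" using s(2) by simp
    also have "\<dots> \<le> real N powr \<delta> * real N powr w"
      using N by (intro mult_right_mono) auto
    finally have \<rho>': "real \<rho> \<le> real N powr (w + \<delta>)"
      by (simp add: powr_add mult.commute)
    have "w' \<in> omega_exponents TYPE('f) a 1 b"
    proof (rule omega_exponent_if_ratfun_rank[OF N(1) d _ _ _ _ _ _ _ _ _ _ \<rho>' \<delta>(2)])
      show "real N powr (1 - \<delta>) \<le> real N"
        using N \<delta> powr_mono[of "1 - \<delta>" 1 "real N"] by simp
    qed (use a b \<delta> N in \<open>auto intro!: dim_pow_ge\<close>)
    then show "omega_rect TYPE('f) a 1 b \<le> w'"
      by (rule omega_rect_le)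
  qed
  then show ?thesis
    unfolding omega_rect_eq_Inf[of _ 1 1]
    using naive_exponent[of 1 1 "min a b", where 'f = 'f] b min.coboundedI2[of b 1 a]
    by (intro cInf_greatest) auto
qed

section \<open>Inverting the separating family\<close>

lemma triple_product_index:
  fixes L M R :: "'f::field mat"
  assumes "L \<in> carrier_mat p n" "M \<in> carrier_mat n n" "R \<in> carrier_mat n s" "a < p" "b < s"
  shows "(L * M * 1\<^sub>m n * R) $$ (a, b) = (\<Sum>(u, v)\<in>{..<n} \<times> {..<n}. L $$ (a, u) * R $$ (v, b) * M $$ (u, v))"
proof -
  have "L * M * 1\<^sub>m n = L * M"
    using assms by (intro right_mult_one_mat[of _ p n]) auto
  then have "(L * M * 1\<^sub>m n * R) $$ (a, b) = (\<Sum>u<n. L $$ (a, u) * (\<Sum>v<n. M $$ (u, v) * R $$ (v, b)))"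
    using assms by (simp add: scalar_prod_def lessThan_atLeast0)
  also have "\<dots> = (\<Sum>u<n. \<Sum>v<n. L $$ (a, u) * R $$ (v, b) * M $$ (u, v))"
    by (simp add: sum_distrib_left mult_ac)
  finally show ?thesis
    by (simp add: sum.cartesian_product)
qed

text \<open>\<open>W\<close> is the matrix of the linear map from \<open>M\<close> to all
  \<open>L i * M * R i\<close>, with rows \<open>(i, a, b)\<close> and columns
  \<open>(u, v)\<close>. A vector in its kernel, read as a matrix, is zero by
  \<open>sep\<close>.\<close>

lemma separating_family_left_inverse:
  fixes L R :: "'i \<Rightarrow> 'f::field mat"
  assumes fin: "finite I"
    and L: "\<And>i. i \<in> I \<Longrightarrow> L i \<in> carrier_mat (p i) n" and R: "\<And>i. i \<in> I \<Longrightarrow> R i \<in> carrier_mat n (s i)"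
    and sep: "\<And>M. M \<in> carrier_mat n n \<Longrightarrow> (\<And>i. i \<in> I \<Longrightarrow> L i * M * 1\<^sub>m n * R i = 0\<^sub>m (p i) (s i)) \<Longrightarrow> M = 0\<^sub>m n n"
  shows "\<exists>c. \<forall>x<n. \<forall>y<n. \<forall>u<n. \<forall>v<n. (\<Sum>i\<in>I. \<Sum>(a, b)\<in>{..<p i} \<times> {..<s i}.
      c x y i a b * (L i $$ (a, u) * R i $$ (v, b))) = of_bool (x = u \<and> y = v)"
proof -
  define A where "A = (SIGMA i:I. {..<p i} \<times> {..<s i})"
  define W where "W t z = L (fst t) $$ (fst (snd t), fst z) * R (fst t) $$ (snd z, snd (snd t))"
    for t :: "'i \<times> nat \<times> nat" and z :: "nat \<times> nat"
  have finA: "finite A" unfolding A_def using fin by auto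
  have "\<exists>c. \<forall>z\<in>{..<n} \<times> {..<n}. \<forall>z'\<in>{..<n} \<times> {..<n}. (\<Sum>t\<in>A. c z t * W t z') = of_bool (z = z')"
  proof (rule left_inverse_exists[OF _ finA])
    fix m z assume m: "\<And>t. t \<in> A \<Longrightarrow> (\<Sum>z\<in>{..<n} \<times> {..<n}. W t z * m z) = 0" and z: "z \<in> {..<n} \<times> {..<n}"
    define M where "M = mat n n m"
    have M: "M \<in> carrier_mat n n" by (simp add: M_def)
    have "L i * M * 1\<^sub>m n * R i = 0\<^sub>m (p i) (s i)" if i: "i \<in> I" for i
    proof (rule eq_matI)
      fix a b assume ab: "a < dim_row (0\<^sub>m (p i) (s i) :: 'f mat)" "b < dim_col (0\<^sub>m (p i) (s i) :: 'f mat)"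
      then have "(L i * M * 1\<^sub>m n * R i) $$ (a, b) = (\<Sum>(u, v)\<in>{..<n} \<times> {..<n}. L i $$ (a, u) * R i $$ (v, b) * M $$ (u, v))"
        by (intro triple_product_index[OF L[OF i] M R[OF i]]) auto
      also have "\<dots> = (\<Sum>z\<in>{..<n} \<times> {..<n}. W (i, a, b) z * m z)"
        by (rule sum.cong) (auto simp: W_def M_def)
      also have "\<dots> = 0"
        using i ab by (intro m) (auto simp: A_def)
      finally show "(L i * M * 1\<^sub>m n * R i) $$ (a, b) = 0\<^sub>m (p i) (s i) $$ (a, b)"
        using ab by simp
    qed (use L[OF i] R[OF i] in auto)
    from sep[OF M this] have "M = 0\<^sub>m n n" by blast
    then have "M $$ z = 0" using z by auto
    then show "m z = 0" using z by (auto simp: M_def)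
  qed auto
  then obtain c where c: "\<And>z z'. z \<in> {..<n} \<times> {..<n} \<Longrightarrow> z' \<in> {..<n} \<times> {..<n} \<Longrightarrow> (\<Sum>t\<in>A. c z t * W t z') = of_bool (z = z')"
    by blast
  have "(\<Sum>i\<in>I. \<Sum>(a, b)\<in>{..<p i} \<times> {..<s i}. c (x, y) (i, a, b) * (L i $$ (a, u) * R i $$ (v, b))) = of_bool (x = u \<and> y = v)"
    if "x < n" "y < n" "u < n" "v < n" for x y u v
  proof -
    have "(\<Sum>i\<in>I. \<Sum>(a, b)\<in>{..<p i} \<times> {..<s i}. c (x, y) (i, a, b) * (L i $$ (a, u) * R i $$ (v, b)))
      = (\<Sum>t\<in>A. c (x, y) t * W t (u, v))"
      unfolding A_def using fin by (subst sum.Sigma) (auto simp: W_def case_prod_beta)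
    also have "\<dots> = of_bool (x = u \<and> y = v)"
      using that by (subst c) auto
    finally show ?thesis .
  qed
  then show ?thesis
    by (intro exI[of _ "\<lambda>x y i a b. c (x, y) (i, a, b)"]) auto
qed

text \<open>The rows of the left inverse and the columns \<open>L i a u * R i v b\<close> are
  biorthogonal families of size \<open>n * n\<close> whose vectors have
  \<open>\<Sum>i\<in>I. p i * s i\<close> coordinates.\<close>

lemma left_inverse_square_le:
  fixes c :: "nat \<Rightarrow> nat \<Rightarrow> 'i \<Rightarrow> nat \<Rightarrow> nat \<Rightarrow> 'f::field"
  assumes fin: "finite I"
    and inv: "\<And>x y u v. x < n \<Longrightarrow> y < n \<Longrightarrow> u < n \<Longrightarrow> v < n \<Longrightarrow>
      (\<Sum>i\<in>I. \<Sum>(a, b)\<in>{..<p i} \<times> {..<s i}. c x y i a b * (L i a u * R i v b)) = of_bool (x = u \<and> y = v)"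
  shows "n * n \<le> (\<Sum>i\<in>I. p i * s i)"
proof -
  let ?A = "SIGMA i:I. {..<p i} \<times> {..<s i}"
  have "card ({..<n} \<times> {..<n}) \<le> card ?A"
  proof (rule biorthogonal_card_le[where X = "\<lambda>z t. c (fst z) (snd z) (fst t) (fst (snd t)) (snd (snd t))"
        and Y = "\<lambda>t z. L (fst t) (fst (snd t)) (fst z) * R (fst t) (snd z) (snd (snd t))"])
    fix z z' assume zz: "z \<in> {..<n} \<times> {..<n}" "z' \<in> {..<n} \<times> {..<n}"
    have "(\<Sum>t\<in>?A. c (fst z) (snd z) (fst t) (fst (snd t)) (snd (snd t))
          * (L (fst t) (fst (snd t)) (fst z') * R (fst t) (snd z') (snd (snd t))))
      = (\<Sum>i\<in>I. \<Sum>(a, b)\<in>{..<p i} \<times> {..<s i}. c (fst z) (snd z) i a b * (L i a (fst z') * R i (snd z') b))"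
      using fin by (subst sum.Sigma) (auto simp: case_prod_beta)
    also have "\<dots> = of_bool (z = z')"
      using zz by (subst inv) (auto simp: prod_eq_iff)
    finally show "(\<Sum>t\<in>?A. c (fst z) (snd z) (fst t) (fst (snd t)) (snd (snd t))
          * (L (fst t) (fst (snd t)) (fst z') * R (fst t) (snd z') (snd (snd t)))) = of_bool (z = z')" .
  qed (use fin in auto)
  then show ?thesis using fin by simp
qed

section \<open>Asymptotic bound for the square format\<close>

text \<open>As \<open>real n powr a\<close> is an integer, rounding is exact at all powers of
  \<open>n\<close>.\<close>

lemma dim_pow_power:
  assumes "real p = real n powr a" "n > 0"
  shows "dim_pow (n ^ c) a = p ^ c"
proof -
  have "real (n ^ c) powr a = real (p ^ c)"
    using assms by (simp add: powr_realpow[symmetric] powr_powr mult.commute)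
  then show ?thesis
    unfolding dim_pow_def by (metis floor_of_nat nat_int)
qed

lemma ratfun_rank_power_bound:
  assumes w: "w \<in> omega_exponents TYPE('f::field) a 1 b" and n: "n > 0"
    and p: "real p = real n powr a" and s: "real s = real n powr b"
  shows "\<exists>C>0. \<forall>c. \<exists>R. mm_dims (UNIV :: 'f ratfun set) (p ^ c) (n ^ c) (s ^ c) R \<and> real R \<le> C * (real n powr w) ^ c"
proof -
  obtain C where C: "C > 0" "\<And>N. N \<ge> 1 \<Longrightarrow> \<exists>t. matmul_in TYPE('f) (dim_pow N a) (dim_pow N 1) (dim_pow N b) t \<and> real t \<le> C * real N powr w"
    using omega_exponentsD[OF w] by blast
  have "\<exists>R. mm_dims (UNIV :: 'f ratfun set) (p ^ c) (n ^ c) (s ^ c) R \<and> real R \<le> (2 * C) * (real n powr w) ^ c" for c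
  proof -
    have "n ^ c \<ge> 1" using n by simp
    then obtain t where t: "matmul_in TYPE('f) (p ^ c) (n ^ c) (s ^ c) t" "real t \<le> C * real (n ^ c) powr w"
      using C(2)[of "n ^ c"] unfolding dim_pow_power[OF p n] dim_pow_power[OF s n] dim_pow_1 by blast
    obtain R where R: "R \<le> 2 * t" "mm_dims (UNIV :: 'f ratfun set) (p ^ c) (n ^ c) (s ^ c) R"
      using matmul_in_imp_mm_dims[OF t(1)] by blast
    have "real R \<le> 2 * real t" using R(1) by linarith
    also have "\<dots> \<le> 2 * (C * real (n ^ c) powr w)" using t(2) by simp
    also have "real (n ^ c) powr w = (real n powr w) ^ c"
      using n by (simp add: powr_realpow[symmetric] powr_powr mult.commute)
    finally show ?thesis using R(2) by auto
  qed
  then show ?thesis using C(1) by (intro exI[of _ "2 * C"]) auto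
qed

text \<open>The format \<open>(n ^ m, n ^ m, n ^ m)\<close> has rank at most
  \<open>C' ^ card I * S ^ m\<close>. To the base \<open>n ^ m\<close>, the exponent of this bound
  is \<open>log n S\<close> plus a term that vanishes as \<open>m\<close> grows.\<close>

lemma omega_le_log_sum:
  fixes c :: "nat \<Rightarrow> nat \<Rightarrow> 'i \<Rightarrow> nat \<Rightarrow> nat \<Rightarrow> 'f::field"
  assumes fin: "finite I" "I \<noteq> {}" and n: "n \<ge> 2"
    and inv: "\<And>x y u v. x < n \<Longrightarrow> y < n \<Longrightarrow> u < n \<Longrightarrow> v < n \<Longrightarrow>
      (\<Sum>i\<in>I. \<Sum>(a, b)\<in>{..<p i} \<times> {..<s i}. c x y i a b * (L i a u * R i v b)) = of_bool (x = u \<and> y = v)"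
    and p: "\<And>i. i \<in> I \<Longrightarrow> real (p i) = real n powr \<alpha> i" and s: "\<And>i. i \<in> I \<Longrightarrow> real (s i) = real n powr \<beta> i"
    and w: "\<And>i. i \<in> I \<Longrightarrow> w i \<in> omega_exponents TYPE('f) (\<alpha> i) 1 (\<beta> i)"
  shows "omega TYPE('f) \<le> log (real n) (\<Sum>i\<in>I. real n powr w i)"
proof -
  let ?rf = "rf_const :: 'f \<Rightarrow> 'f ratfun"
  have n0: "n > 0" "real n > 1" using n by simp_all
  have rf_sum: "?rf (sum t A) = (\<Sum>x\<in>A. ?rf (t x))" for t :: "'z \<Rightarrow> 'f" and A
    by (induction A rule: infinite_finite_induct) (simp_all add: rf_const_simps)
  have invK: "(\<Sum>i\<in>I. \<Sum>(a, b)\<in>{..<p i} \<times> {..<s i}. ?rf (c x y i a b) * (?rf (L i a u) * ?rf (R i v b)))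
      = of_bool (x = u \<and> y = v)" if "x < n" "y < n" "u < n" "v < n" for x y u v
    using arg_cong[OF inv[OF that], of ?rf]
    by (simp add: rf_sum rf_const_simps case_prod_beta of_bool_def split: if_splits)
  have reduce: "mm_dims (UNIV :: 'f ratfun set) (n * P) Q (n * T) (\<Sum>i\<in>I. \<rho> i)"
    if "\<And>i. i \<in> I \<Longrightarrow> mm_dims (UNIV :: 'f ratfun set) (p i * P) Q (s i * T) (\<rho> i)" for P Q T \<rho>
    by (rule mm_dims_reduce[OF fin(1) invK that])
  have exC: "\<exists>C>0. \<forall>m. \<exists>r. mm_dims (UNIV :: 'f ratfun set) (p i ^ m) (n ^ m) (s i ^ m) r \<and> real r \<le> C * (real n powr w i) ^ m"
    if "i \<in> I" for i
    by (rule ratfun_rank_power_bound[OF w[OF that] n0(1) p[OF that] s[OF that]])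
  define C where "C i = (SOME C. C > 0 \<and> (\<forall>m. \<exists>r. mm_dims (UNIV :: 'f ratfun set) (p i ^ m) (n ^ m) (s i ^ m) r
      \<and> real r \<le> C * (real n powr w i) ^ m))" for i
  have C: "C i > 0"
    "\<exists>r. mm_dims (UNIV :: 'f ratfun set) (p i ^ m) (n ^ m) (s i ^ m) r \<and> real r \<le> C i * (real n powr w i) ^ m"
    if "i \<in> I" for i m
    using someI_ex[OF exC[OF that]] unfolding C_def by simp_all
  \<comment> \<open>One constant for all \<open>i\<close>: a sum of positive numbers dominates each
    of them.\<close>
  define C' where "C' = (\<Sum>i\<in>I. C i)"
  have C'0: "C' > 0" unfolding C'_def using fin C(1) by (intro sum_pos) auto
  define S where "S = (\<Sum>i\<in>I. real n powr w i)"
  have S0: "S > 0" unfolding S_def using fin n0 by (intro sum_pos) auto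
  have base: "\<exists>r. mm_dims (UNIV :: 'f ratfun set) (p i ^ m) (n ^ m) (s i ^ m) r \<and> real r \<le> C' * (real n powr w i) ^ m"
    if i: "i \<in> I" for i m
  proof -
    have "C i \<le> C'"
      unfolding C'_def using fin C(1) i by (intro member_le_sum) (auto intro: less_imp_le)
    then have "C i * (real n powr w i) ^ m \<le> C' * (real n powr w i) ^ m"
      by (intro mult_right_mono) auto
    then show ?thesis using C(2)[OF i, of m] by (meson order_trans)
  qed
  have bound: "omega TYPE('f) \<le> log (real n) S + real (card I) * log (real n) C' / real m" if m: "m \<ge> 1" for m :: nat
  proof (rule dense_ge)
    define w0 where "w0 = log (real n) S + real (card I) * log (real n) C' / real m"
    fix w' assume w': "log (real n) S + real (card I) * log (real n) C' / real m < w'"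
    have "\<exists>r. mm_dims (UNIV :: 'f ratfun set) (n ^ m * (\<Prod>i\<in>I. p i ^ 0)) (n ^ (m + (\<Sum>i\<in>I. 0))) (n ^ m * (\<Prod>i\<in>I. s i ^ 0)) r
        \<and> real r \<le> C' ^ card I * (\<Sum>i\<in>I. real n powr w i) ^ m * (\<Prod>i\<in>I. (real n powr w i) ^ 0)"
    proof (rule mm_dims_power_bound[OF fin(1) less_imp_le[OF C'0]])
      fix P Q T \<rho>
      assume "\<And>i. i \<in> I \<Longrightarrow> mm_dims (UNIV :: 'f ratfun set) (p i * P) Q (s i * T) (\<rho> i)"
      then show "mm_dims (UNIV :: 'f ratfun set) (n * P) Q (n * T) (\<Sum>i\<in>I. \<rho> i)"
        by (rule reduce)
    qed (simp_all add: base)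
    then obtain r where r: "mm_dims (UNIV :: 'f ratfun set) (n ^ m) (n ^ m) (n ^ m) r" "real r \<le> C' ^ card I * S ^ m"
      by (auto simp: S_def)
    have "n \<le> n ^ m" using m n by (simp add: self_le_power)
    then have nm: "n ^ m \<ge> 2" using n by linarith
    have "real (n ^ m) powr w0 = real n powr (real m * w0)"
      using n0 by (simp add: powr_realpow[symmetric] powr_powr)
    also have "real m * w0 = log (real n) S * real m + log (real n) C' * real (card I)"
      using m by (simp add: w0_def field_simps)
    also have "real n powr \<dots> = S ^ m * C' ^ card I"
      using n0 S0 C'0 by (simp add: powr_add powr_powr[symmetric] powr_realpow)
    finally have r': "real r \<le> real (n ^ m) powr w0" using r(2) by (simp add: mult.commute)
    have "w' \<in> omega_exponents TYPE('f) 1 1 1"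
      \<comment> \<open>The dimensions are exact powers of the base \<open>n ^ m\<close>, so no
        rounding loss arises and \<open>\<delta> = 0\<close> is allowed.\<close>
      by (rule omega_exponent_if_ratfun_rank[OF nm r(1), where \<delta> = 0 and w = w0])
         (use r' w' in \<open>auto simp: w0_def simp del: of_nat_power\<close>)
    then show "omega TYPE('f) \<le> w'"
      unfolding omega_def by (rule omega_rect_le)
  qed
  have "(\<lambda>m. log (real n) S + real (card I) * log (real n) C' / real m) \<longlonglongrightarrow> log (real n) S + 0"
    by (intro tendsto_add tendsto_const lim_const_over_n)
  then have "omega TYPE('f) \<le> log (real n) S + 0"
    by (rule LIMSEQ_le_const) (use bound in blast)
  then show ?thesis by (simp add: S_def)
qed

theorem theorem3p7:
  fixes n k :: nat
    and L R :: "nat \<Rightarrow> 'f::field mat"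
    and \<alpha> \<beta> :: "nat \<Rightarrow> real"
  assumes n_pos: "0 < n"
    and alpha: "\<And>i. i \<in> {1..k} \<Longrightarrow> 0 \<le> \<alpha> i \<and> \<alpha> i \<le> 1"
    and beta: "\<And>i. i \<in> {1..k} \<Longrightarrow> 0 \<le> \<beta> i \<and> \<beta> i \<le> 1"
    and L_dim: "\<And>i. i \<in> {1..k} \<Longrightarrow>
       real (dim_row (L i)) = real n powr \<alpha> i \<and> dim_col (L i) = n"
    and R_dim: "\<And>i. i \<in> {1..k} \<Longrightarrow>
       dim_row (R i) = n \<and> real (dim_col (R i)) = real n powr \<beta> i"
    and L_rank: "\<And>i. i \<in> {1..k} \<Longrightarrow>
       real (vec_space.rank (dim_row (L i)) (L i)) = real n powr \<alpha> i"
    and R_rank: "\<And>i. i \<in> {1..k} \<Longrightarrow>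
       real (vec_space.rank (dim_row (R i)) (R i)) = real n powr \<beta> i"
    and zero_iff: "\<And>A B. A \<in> carrier_mat n n \<Longrightarrow> B \<in> carrier_mat n n \<Longrightarrow>
       A * B = 0\<^sub>m n n \<longleftrightarrow>
       (\<forall>i\<in>{1..k}. L i * A * B * R i = 0\<^sub>m (dim_row (L i)) (dim_col (R i)))"
  shows "(\<Sum>i=1..k. real n powr (\<alpha> i + \<beta> i)) \<ge> (real n)\<^sup>2
       \<and> (\<Sum>i=1..k. real n powr omega_rect TYPE('f) 1 1 (min (\<alpha> i) (\<beta> i)))
            \<ge> (\<Sum>i=1..k. real n powr omega_rect TYPE('f) (\<alpha> i) 1 (\<beta> i))
       \<and> (\<Sum>i=1..k. real n powr omega_rect TYPE('f) (\<alpha> i) 1 (\<beta> i))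
            \<ge> real n powr omega TYPE('f)"
proof -
  define p where "p i = dim_row (L i)" for i
  define s where "s i = dim_col (R i)" for i
  have p: "real (p i) = real n powr \<alpha> i" and s: "real (s i) = real n powr \<beta> i" if "i \<in> {1..k}" for i
    using L_dim[OF that] R_dim[OF that] by (simp_all add: p_def s_def)
  \<comment> \<open>For \<open>B = 1\<close> the hypothesis says that only \<open>M = 0\<close> is
    sent to zero by all the two-sided multiplications.\<close>
  have sep: "M = 0\<^sub>m n n"
    if M: "M \<in> carrier_mat n n" and zero: "\<And>i. i \<in> {1..k} \<Longrightarrow> L i * M * 1\<^sub>m n * R i = 0\<^sub>m (p i) (s i)" for M
  proof -
    have "M * 1\<^sub>m n = 0\<^sub>m n n"
      using zero_iff[OF M, of "1\<^sub>m n"] zero by (simp add: p_def s_def)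
    then show ?thesis using M by simp
  qed
  have LR: "L i \<in> carrier_mat (p i) n" "R i \<in> carrier_mat n (s i)" if "i \<in> {1..k}" for i
    unfolding p_def s_def
    using conjunct2[OF L_dim[OF that]] conjunct1[OF R_dim[OF that]] by (blast intro: carrier_matI)+
  have "\<exists>c. \<forall>x<n. \<forall>y<n. \<forall>u<n. \<forall>v<n. (\<Sum>i\<in>{1..k}. \<Sum>(a, b)\<in>{..<p i} \<times> {..<s i}.
      c x y i a b * (L i $$ (a, u) * R i $$ (v, b))) = of_bool (x = u \<and> y = v)"
  proof (rule separating_family_left_inverse)
    fix M assume "M \<in> carrier_mat n n" "\<And>i. i \<in> {1..k} \<Longrightarrow> L i * M * 1\<^sub>m n * R i = 0\<^sub>m (p i) (s i)"
    then show "M = 0\<^sub>m n n" by (rule sep)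
  qed (auto intro: LR)
  then obtain c where c: "\<forall>x<n. \<forall>y<n. \<forall>u<n. \<forall>v<n. (\<Sum>i\<in>{1..k}. \<Sum>(a, b)\<in>{..<p i} \<times> {..<s i}.
      c x y i a b * (L i $$ (a, u) * R i $$ (v, b))) = of_bool (x = u \<and> y = v)"
    by blast
  have inv: "(\<Sum>i\<in>{1..k}. \<Sum>(a, b)\<in>{..<p i} \<times> {..<s i}.
      c x y i a b * (L i $$ (a, u) * R i $$ (v, b))) = of_bool (x = u \<and> y = v)"
    if "x < n" "y < n" "u < n" "v < n" for x y u v
    using c that by simp
  have "n * n \<le> (\<Sum>i=1..k. p i * s i)"
    by (rule left_inverse_square_le[where L = "\<lambda>i a u. L i $$ (a, u)" and R = "\<lambda>i v b. R i $$ (v, b)", OF _ inv]) auto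
  then have "real (n * n) \<le> real (\<Sum>i=1..k. p i * s i)"
    by (rule of_nat_mono)
  also have "\<dots> = (\<Sum>i=1..k. real n powr (\<alpha> i + \<beta> i))"
    unfolding of_nat_sum of_nat_mult by (intro sum.cong refl) (simp add: p s powr_add)
  finally have part1: "(real n)\<^sup>2 \<le> (\<Sum>i=1..k. real n powr (\<alpha> i + \<beta> i))"
    by (simp add: power2_eq_square)
  \<comment> \<open>An empty family would contradict the first inequality, as the empty sum is 0 and
    \<open>n\<close> is positive.\<close>
  have k: "{1..k} \<noteq> {}"
    using part1 n_pos by (cases "k = 0") auto
  have part2: "(\<Sum>i=1..k. real n powr omega_rect TYPE('f) (\<alpha> i) 1 (\<beta> i))
      \<le> (\<Sum>i=1..k. real n powr omega_rect TYPE('f) 1 1 (min (\<alpha> i) (\<beta> i)))"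
    using alpha beta n_pos by (intro sum_mono powr_mono omega_rect_le_omega_rect_min) auto
  let ?S = "\<Sum>i=1..k. real n powr omega_rect TYPE('f) (\<alpha> i) 1 (\<beta> i)"
  have part3: "real n powr omega TYPE('f) \<le> ?S"
  proof (cases "n = 1")
    \<comment> \<open>Logarithms to base 1 are degenerate; here every power is 1 and the sum counts
      the nonempty index set.\<close>
    case True
    then show ?thesis using k by (cases k) auto
  next
    case False
    then have n: "n \<ge> 2" "real n > 1" using n_pos by simp_all
    have S0: "?S > 0" using k n by (intro sum_pos) auto
    \<comment> \<open>The infima need not be attained, so exponents within \<open>\<epsilon>\<close>
      of them are used; this multiplies the sum by at most
      \<open>real n powr \<epsilon>\<close>.\<close>
    have "omega TYPE('f) \<le> log (real n) ?S + \<epsilon>" if \<epsilon>: "\<epsilon> > 0" for \<epsilon>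
    proof -
      have "\<exists>w\<in>omega_exponents TYPE('f) (\<alpha> i) 1 (\<beta> i). w < omega_rect TYPE('f) (\<alpha> i) 1 (\<beta> i) + \<epsilon>" if "i \<in> {1..k}" for i
        by (rule omega_rect_approx) (use alpha[OF that] beta[OF that] \<epsilon> in auto)
      then obtain w where w: "\<And>i. i \<in> {1..k} \<Longrightarrow> w i \<in> omega_exponents TYPE('f) (\<alpha> i) 1 (\<beta> i)"
        "\<And>i. i \<in> {1..k} \<Longrightarrow> w i < omega_rect TYPE('f) (\<alpha> i) 1 (\<beta> i) + \<epsilon>"
        by metis
      have "omega TYPE('f) \<le> log (real n) (\<Sum>i=1..k. real n powr w i)"
        by (rule omega_le_log_sum[where L = "\<lambda>i a u. L i $$ (a, u)" and R = "\<lambda>i v b. R i $$ (v, b)",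
              OF _ k n(1) inv p s w(1)]) auto
      also have "\<dots> \<le> log (real n) (\<Sum>i=1..k. real n powr (omega_rect TYPE('f) (\<alpha> i) 1 (\<beta> i) + \<epsilon>))"
      proof (rule log_mono)
        show "(\<Sum>i=1..k. real n powr w i) > 0"
          using k n by (intro sum_pos) auto
        show "(\<Sum>i=1..k. real n powr w i) \<le> (\<Sum>i=1..k. real n powr (omega_rect TYPE('f) (\<alpha> i) 1 (\<beta> i) + \<epsilon>))"
          using n w(2) by (intro sum_mono powr_mono) (auto intro: less_imp_le)
      qed (use n in auto)
      also have "(\<Sum>i=1..k. real n powr (omega_rect TYPE('f) (\<alpha> i) 1 (\<beta> i) + \<epsilon>)) = ?S * real n powr \<epsilon>"
        by (simp add: powr_add sum_distrib_right)
      also have "log (real n) (?S * real n powr \<epsilon>) = log (real n) ?S + \<epsilon>"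
        using S0 n by (simp add: log_mult)
      finally show ?thesis .
    qed
    then have "omega TYPE('f) \<le> log (real n) ?S"
      by (rule field_le_epsilon)
    then show ?thesis
      using n S0 by (simp add: le_log_iff)
  qed
  from part1 part2 part3 show ?thesis by blast
qed

end
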